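(* Let $p$ be a prime number, and let $\ell$ be an integer greater than $1$. Then there is a homogeneous polynomial $f_{p,\ell}\colon \mathbb{C}^{\ell+1}\to\mathbb{C}$ such that, writing $M=\mathbb{C}^{\ell+1}\setminus f_{p,\ell}^{-1}(0)$ and $F=f_{p,\ell}^{-1}(1)$, the integral homology $H_*(M;\mathbb{Z})$ is torsion-free, but $H_1(F;\mathbb{Z})$ has $p$-torsion.
   Context: For a homogeneous polynomial $f\colon(\mathbb{C}^{\ell+1},\mathbf{0})\to(\mathbb{C},0)$, $M=\mathbb{C}^{\ell+1}\setminus f^{-1}(0)$ is the complement of the hypersurface defined by $f$, and $F=f^{-1}(1)$ is the Milnor fiber of the bundle map $f\colon M\to\mathbb{C}^*$. An abelian group has $p$-torsion if it contains an element of order $p$. *)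

theory Defs
  imports "HOL-Homology.Homology" "HOL-Computational_Algebra.Primes"
begin

(* A polynomial function on complex n-space all of whose monomials have degree d; the
   coordinates are indexed by the type 'n, and an exponent vector is a function on 'n. Over
   the infinite field of complex numbers, polynomials and polynomial functions coincide. As
   usual the zero polynomial is homogeneous of every degree. *)
definition homogeneous_polynomial :: "nat \<Rightarrow> (complex ^ 'n \<Rightarrow> complex) \<Rightarrow> bool"
  where "homogeneous_polynomial d f \<longleftrightarrow>
    (\<exists>(A :: ('n \<Rightarrow> nat) set) (c :: ('n \<Rightarrow> nat) \<Rightarrow> complex).
       finite A \<and> (\<forall>a\<in>A. (\<Sum>i\<in>UNIV. a i) = d) \<and>
       (\<forall>x. f x = (\<Sum>a\<in>A. c a * (\<Prod>i\<in>UNIV. (x $ i) ^ a i))))"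

definition hypersurface_complement :: "(complex ^ 'n \<Rightarrow> complex) \<Rightarrow> (complex ^ 'n) set"
  where "hypersurface_complement f = UNIV - f -` {0}"

definition milnor_fiber :: "(complex ^ 'n \<Rightarrow> complex) \<Rightarrow> (complex ^ 'n) set"
  where "milnor_fiber f = f -` {1}"

definition torsion_free_group :: "('a, 'b) monoid_scheme \<Rightarrow> bool"
  where "torsion_free_group G \<longleftrightarrow>
    (\<forall>x\<in>carrier G. \<forall>n::nat. n > 0 \<and> x [^]\<^bsub>G\<^esub> n = \<one>\<^bsub>G\<^esub> \<longrightarrow> x = \<one>\<^bsub>G\<^esub>)"

definition has_p_torsion :: "nat \<Rightarrow> ('a, 'b) monoid_scheme \<Rightarrow> bool"
  where "has_p_torsion p G \<longleftrightarrow> (\<exists>x\<in>carrier G. group.ord G x = p)"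

end

theory Submission
  imports Defs "HOL-Analysis.Analysis"
begin

text \<open>
  Take \<open>f = x z\<^bsup>p+1\<^esup> (x z\<^bsup>p-1\<^esup> - y\<^sup>p)\<close> in three of the coordinates. The complement is homotopy
  equivalent to the product of \<open>\<complex>\<^sup>*\<close> with the complement of the curves \<open>x = 0\<close> and \<open>x = y\<^sup>p\<close> in
  \<open>\<complex>\<^sup>2\<close>. These curves form a closed set homeomorphic to two crossing lines, so by Alexander duality
  the second factor has the homology of \<open>\<complex>\<^sup>* \<times> \<complex>\<^sup>*\<close>, and products with \<open>\<complex>\<^sup>*\<close> preserve torsion-free homology.

  On the Milnor fiber the functions \<open>X = x z\<^sup>p\<close>, \<open>Y = y\<close> and \<open>W = X z\<close> satisfy \<open>X\<^sup>2 - 1 = W Y\<^sup>p\<close> with \<open>X\<close> and \<open>W\<close>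
  nonzero, and the three coordinates can be recovered from them. Thus \<open>X\<close> is a fibration over \<open>\<complex>\<^sup>*\<close> with
  fibers \<open>\<complex>\<^sup>*\<close>, apart from two fibers of multiplicity \<open>p\<close> over \<open>X = \<plusminus>1\<close>. Each of these, traversed \<open>p\<close> times, is a
  regular fiber, so \<open>p\<close> kills the difference of their classes. The difference is nonzero because it is
  detected by a class in \<open>H\<^sup>1(F; \<int>/p)\<close>, glued from the functions \<open>W / (X + 1)\<close> on \<open>X \<noteq> -1\<close> and \<open>X - 1\<close> on
  \<open>X \<noteq> 1\<close>, whose quotient on the overlap is the \<open>p\<close>-th power of \<open>1 / Y\<close>.
\<close>

section \<open>Torsion-free homology\<close>

definition torsion_free_homology :: "'a topology \<Rightarrow> bool"
  where "torsion_free_homology X \<longleftrightarrow> (\<forall>q. torsion_free_group (homology_group q X))"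

lemma torsion_free_groupD:
  fixes n :: nat
  assumes "torsion_free_group G" "x \<in> carrier G" "0 < n" "x [^]\<^bsub>G\<^esub> n = \<one>\<^bsub>G\<^esub>"
  shows "x = \<one>\<^bsub>G\<^esub>"
  using assms by (auto simp: torsion_free_group_def)

lemma torsion_free_homologyD:
  "torsion_free_homology X \<Longrightarrow> torsion_free_group (homology_group q X)"
  by (simp add: torsion_free_homology_def)

lemma torsion_free_group_inj:
  assumes "group G" "group H" and h: "h \<in> hom G H" and inj: "inj_on h (carrier G)"
    and H: "torsion_free_group H"
  shows "torsion_free_group G"
  unfolding torsion_free_group_def
proof clarify
  fix x and n :: nat
  assume x: "x \<in> carrier G" and n: "0 < n" "x [^]\<^bsub>G\<^esub> n = \<one>\<^bsub>G\<^esub>"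
  interpret group_hom G H h
    by (simp add: assms group_hom_axioms.intro group_hom_def)
  have "h x [^]\<^bsub>H\<^esub> n = \<one>\<^bsub>H\<^esub>"
    using hom_nat_pow [OF x, of n] n by simp
  then have "h x = \<one>\<^bsub>H\<^esub>"
    using torsion_free_groupD [OF H hom_closed [OF x]] n by blast
  then have "h x = h \<one>\<^bsub>G\<^esub>"
    by simp
  then show "x = \<one>\<^bsub>G\<^esub>"
    using inj_onD [OF inj _ x G.one_closed] by blast
qed

lemma torsion_free_group_iso:
  assumes "group G" "group H" "G \<cong> H" "torsion_free_group H"
  shows "torsion_free_group G"
  using assms by (auto simp: is_iso_def iso_def bij_betw_def intro: torsion_free_group_inj)

lemma torsion_free_trivial_group: "trivial_group G \<Longrightarrow> torsion_free_group G"
  by (auto simp: trivial_group_def torsion_free_group_def)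

lemma torsion_free_integer_group: "torsion_free_group integer_group"
proof -
  have "x [^]\<^bsub>integer_group\<^esub> n = int n * x" for x :: int and n :: nat
    by (induction n) (auto simp: algebra_simps)
  then show ?thesis
    by (auto simp: torsion_free_group_def)
qed

text \<open>Straight segments contract \<open>S\<close> to the star centre \<open>a\<close>; a
  second contraction, applied to the constant map at \<open>b\<close> and reversed, moves the target
  to any chosen point of \<open>S\<close>. This allows a concrete \<open>b\<close> even when the
  centre is known only to exist.\<close>

lemma homotopic_canon_starlike:
  fixes a :: "'a :: real_normed_vector"
  assumes "\<And>z. z \<in> S \<Longrightarrow> closed_segment a z \<subseteq> S" and "b \<in> S"
  shows "homotopic_with_canon (\<lambda>_. True) S S id (\<lambda>_. b)"
proof -
  have seg: "closed_segment z a \<subseteq> S" if "z \<in> S" for z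
    using assms(1) [OF that] by (simp add: closed_segment_commute)
  have "homotopic_with_canon (\<lambda>_. True) S S (\<lambda>z. z) (\<lambda>_. a)"
    using seg by (intro homotopic_with_linear) auto
  moreover have "homotopic_with_canon (\<lambda>_. True) S S (\<lambda>_. b) (\<lambda>_. a)"
    using seg [OF \<open>b \<in> S\<close>] by (intro homotopic_with_linear) auto
  ultimately show ?thesis
    unfolding id_def using homotopic_with_symD homotopic_with_trans by blast
qed

text \<open>The homotopy gives the map induced by \<open>r\<close> a left inverse on homology. So
  the homology of \<open>X\<close> embeds in that of \<open>N\<close>, and torsion-freeness passes
  to subgroups.\<close>

lemma torsion_free_homology_dominated:
  assumes N: "torsion_free_homology N"
    and r: "continuous_map X N r" and s: "continuous_map N X s"
    and "homotopic_with (\<lambda>_. True) X X (s \<circ> r) id"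
  shows "torsion_free_homology X"
  unfolding torsion_free_homology_def
proof
  fix q
  let ?r = "hom_induced q X {} N {} r" and ?s = "hom_induced q N {} X {} s"
  have "?s (?r c) = c" if "c \<in> carrier (homology_group q X)" for c
  proof -
    have "?s (?r c) = hom_induced q X {} X {} (s \<circ> r) c"
      using r s by (simp add: hom_induced_compose')
    also have "\<dots> = hom_induced q X {} X {} id c"
      using homology_homotopy_empty [OF assms(4)] by metis
    finally show ?thesis
      using that by (simp add: hom_induced_id)
  qed
  then have "inj_on ?r (carrier (homology_group q X))"
    by (rule inj_on_inverseI)
  then show "torsion_free_group (homology_group q X)"
    using torsion_free_group_inj [OF group_relative_homology_group group_relative_homology_group
        hom_induced_hom _ torsion_free_homologyD [OF N]] by blast
qed

lemma torsion_free_homology_singleton: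
  assumes "topspace X = {a}"
  shows "torsion_free_homology X"
  unfolding torsion_free_homology_def
proof
  fix q :: int
  show "torsion_free_group (homology_group q X)"
  proof (cases "q = 0")
    case True
    then show ?thesis
      using torsion_free_group_iso [OF group_relative_homology_group group_integer_group
          homology_coefficients [OF assms] torsion_free_integer_group] by simp
  next
    case False
    then show ?thesis
      by (intro torsion_free_trivial_group homology_dimension_axiom [OF assms])
  qed
qed

text \<open>In the long exact sequence of the pair, a torsion class of \<open>X\<close> dies in the
  relative group, hence comes from \<open>T\<close>; by injectivity its preimage is torsion as well,
  hence trivial.\<close>

lemma torsion_free_homology_extension:
  assumes T: "torsion_free_homology (subtopology X T)"
    and rel: "\<And>q. torsion_free_group (relative_homology_group q X T)"
    and inj: "\<And>q. inj_on (hom_induced q (subtopology X T) {} X {} id)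
                 (carrier (homology_group q (subtopology X T)))"
  shows "torsion_free_homology X"
  unfolding torsion_free_homology_def torsion_free_group_def
proof (intro allI ballI impI)
  fix q :: int and x and n :: nat
  let ?T = "homology_group q (subtopology X T)" and ?X = "homology_group q X"
    and ?R = "relative_homology_group q X T"
  let ?i = "hom_induced q (subtopology X T) {} X {} id"
    and ?j = "hom_induced q X {} X T id"
  assume x: "x \<in> carrier ?X" and n: "0 < n \<and> x [^]\<^bsub>?X\<^esub> n = \<one>\<^bsub>?X\<^esub>"
  interpret i: group_hom ?T ?X ?i
    by (simp add: group_hom_def group_hom_axioms_def hom_induced_hom)
  interpret j: group_hom ?X ?R ?j
    by (simp add: group_hom_def group_hom_axioms_def hom_induced_hom)
  have "?j x [^]\<^bsub>?R\<^esub> n = \<one>\<^bsub>?R\<^esub>"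
    using j.hom_nat_pow [OF x, of n] n by simp
  then have "?j x = \<one>\<^bsub>?R\<^esub>"
    using torsion_free_groupD [OF rel j.hom_closed [OF x]] n by blast
  then have "x \<in> kernel ?X ?R ?j"
    using x by (simp add: kernel_def)
  then obtain y where y: "y \<in> carrier ?T" "x = ?i y"
    using homology_exactness_axiom_3 [of q X T] by auto
  have "?i (y [^]\<^bsub>?T\<^esub> n) = \<one>\<^bsub>?X\<^esub>"
    using y n by (simp add: i.hom_nat_pow)
  then have "y [^]\<^bsub>?T\<^esub> n = \<one>\<^bsub>?T\<^esub>"
    using inj_onD [OF inj [of q], of "y [^]\<^bsub>?T\<^esub> n" "\<one>\<^bsub>?T\<^esub>"] y by simp
  then have "y = \<one>\<^bsub>?T\<^esub>"
    using torsion_free_groupD [OF torsion_free_homologyD [OF T] y(1)] n by blast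
  then show "x = \<one>\<^bsub>?X\<^esub>"
    using y by simp
qed

text \<open>Surjectivity makes the map from the homology of \<open>X\<close> to the relative group
  zero, so by exactness the connecting map embeds the relative group in the homology of
  \<open>T\<close>, one degree lower.\<close>

lemma torsion_free_relative_homology:
  assumes T: "torsion_free_homology (subtopology X T)"
    and surj: "\<And>q. hom_induced q (subtopology X T) {} X {} id
                    ` carrier (homology_group q (subtopology X T)) = carrier (homology_group q X)"
  shows "torsion_free_group (relative_homology_group q X T)"
  unfolding torsion_free_group_def
proof (intro allI ballI impI)
  fix x and n :: nat
  let ?T = "homology_group q (subtopology X T)" and ?X = "homology_group q X"
    and ?R = "relative_homology_group q X T" and ?T' = "homology_group (q - 1) (subtopology X T)"
  let ?i = "hom_induced q (subtopology X T) {} X {} id"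
    and ?j = "hom_induced q X {} X T id" and ?b = "hom_boundary q X T"
  assume x: "x \<in> carrier ?R" and n: "0 < n \<and> x [^]\<^bsub>?R\<^esub> n = \<one>\<^bsub>?R\<^esub>"
  interpret b: group_hom ?R ?T' ?b
    by (simp add: group_hom_def group_hom_axioms_def hom_boundary_hom)
  have "?b x [^]\<^bsub>?T'\<^esub> n = \<one>\<^bsub>?T'\<^esub>"
    using b.hom_nat_pow [OF x, of n] n by simp
  then have "?b x = \<one>\<^bsub>?T'\<^esub>"
    using torsion_free_groupD [OF torsion_free_homologyD [OF T] b.hom_closed [OF x]] n by blast
  then have "x \<in> kernel ?R ?T' ?b"
    using x by (simp add: kernel_def)
  then obtain y where y: "y \<in> carrier ?X" "x = ?j y"
    using homology_exactness_axiom_1 [of q X T] by auto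
  then obtain t where "t \<in> carrier ?T" "y = ?i t"
    using surj [of q] by blast
  then have "y \<in> kernel ?X ?R ?j"
    using homology_exactness_axiom_3 [of q X T] by auto
  then show "x = \<one>\<^bsub>?R\<^esub>"
    using y by (simp add: kernel_def)
qed

lemma torsion_free_relative_homology_excision:
  assumes "X closure_of U \<subseteq> X interior_of T" "T \<subseteq> topspace X"
    and "torsion_free_group (relative_homology_group q (subtopology X (topspace X - U)) (T - U))"
  shows "torsion_free_group (relative_homology_group q X T)"
proof -
  have "relative_homology_group q (subtopology X (topspace X - U)) (T - U) \<cong> relative_homology_group q X T"
    using homology_excision_axiom [OF assms(1,2), of q] by (auto simp: is_iso_def)
  then show ?thesis
    by (meson assms(3) group.iso_sym group_relative_homology_group torsion_free_group_iso)
qed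

section \<open>Products of a space with subsets of the complex plane\<close>

context
  fixes X :: "'a topology"
begin

abbreviation slab :: "complex set \<Rightarrow> ('a \<times> complex) topology"
  where "slab S \<equiv> prod_topology X (top_of_set S)"

lemma slab_subtopology: "subtopology (slab S) (topspace X \<times> T) = slab (S \<inter> T)"
  by (simp add: subtopology_Times subtopology_subtopology)

lemma homotopic_slab:
  assumes "homotopic_with_canon (\<lambda>_. True) S S id (\<lambda>_. a)"
  shows "homotopic_with (\<lambda>_. True) (slab S) (slab S) (\<lambda>(x,z). (x,a)) id"
proof -
  have "homotopic_with (\<lambda>_. True) (slab S) (slab S) (\<lambda>z. (id (fst z), id (snd z))) (\<lambda>z. (id (fst z), a))"
    using homotopic_with_prod_topology [of "\<lambda>_. True" X X id id "\<lambda>_. True" "top_of_set S" "top_of_set S" id "\<lambda>_. a" "\<lambda>_. True"] assms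
    by (simp add: case_prod_unfold)
  then show ?thesis
    by (simp add: homotopic_with_sym case_prod_unfold id_def)
qed

lemma continuous_map_slab_const:
  "a \<in> S' \<Longrightarrow> continuous_map (slab S) (slab S') (\<lambda>(x,z). (x,a))"
  by (auto simp: case_prod_unfold continuous_map_pairwise o_def continuous_map_fst)

lemma continuous_map_slab_inclusion:
  assumes "S \<subseteq> S'"
  shows "continuous_map (slab S) (slab S') id"
proof -
  have "slab S = subtopology (slab S') (topspace X \<times> S)"
    using assms by (simp add: slab_subtopology Int_absorb1)
  then show ?thesis
    by (metis continuous_map_from_subtopology continuous_map_id)
qed

text \<open>Collapsing the second factor to \<open>a\<close> maps the larger slab back to the
  smaller one. Restricted to the smaller slab it is homotopic to the identity, which gives a left
  inverse on homology.\<close>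

lemma inj_on_slab:
  assumes h: "homotopic_with_canon (\<lambda>_. True) S S id (\<lambda>_. a)" and "a \<in> S" "S \<subseteq> S'"
  shows "inj_on (hom_induced q (slab S) {} (slab S') {} id) (carrier (homology_group q (slab S)))"
proof -
  let ?k = "\<lambda>(x,z). (x,a)"
  have i: "continuous_map (slab S) (slab S') id"
    using \<open>S \<subseteq> S'\<close> by (rule continuous_map_slab_inclusion)
  have "hom_induced q (slab S') {} (slab S) {} ?k (hom_induced q (slab S) {} (slab S') {} id c) = c"
    if "c \<in> carrier (homology_group q (slab S))" for c
  proof -
    have "hom_induced q (slab S') {} (slab S) {} ?k (hom_induced q (slab S) {} (slab S') {} id c)
      = hom_induced q (slab S) {} (slab S) {} (?k \<circ> id) c"
      using i \<open>a \<in> S\<close> by (simp add: hom_induced_compose' continuous_map_slab_const)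
    also have "\<dots> = hom_induced q (slab S) {} (slab S) {} id c"
      using homology_homotopy_empty [OF homotopic_slab [OF h]] by (metis comp_id)
    finally show ?thesis
      using that by (simp add: hom_induced_id)
  qed
  then show ?thesis
    by (rule inj_on_inverseI)
qed

text \<open>Here it is the larger set that contracts to a point \<open>a\<close> of the smaller one,
  so the same collapsing map is a right inverse of the inclusion on homology.\<close>

lemma surj_slab:
  assumes h: "homotopic_with_canon (\<lambda>_. True) S' S' id (\<lambda>_. a)" and "a \<in> S" "S \<subseteq> S'"
  shows "hom_induced q (slab S) {} (slab S') {} id ` carrier (homology_group q (slab S))
       = carrier (homology_group q (slab S'))"
proof -
  let ?k = "\<lambda>(x,z). (x,a)"
  have i: "continuous_map (slab S) (slab S') id"
    using \<open>S \<subseteq> S'\<close> by (rule continuous_map_slab_inclusion)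
  have "hom_induced q (slab S) {} (slab S') {} id (hom_induced q (slab S') {} (slab S) {} ?k c) = c"
    if "c \<in> carrier (homology_group q (slab S'))" for c
  proof -
    have "hom_induced q (slab S) {} (slab S') {} id (hom_induced q (slab S') {} (slab S) {} ?k c)
      = hom_induced q (slab S') {} (slab S') {} (id \<circ> ?k) c"
      using i \<open>a \<in> S\<close> by (simp add: hom_induced_compose' continuous_map_slab_const)
    also have "\<dots> = hom_induced q (slab S') {} (slab S') {} id c"
      using homology_homotopy_empty [OF homotopic_slab [OF h]] by (metis id_comp)
    finally show ?thesis
      using that by (simp add: hom_induced_id)
  qed
  then have "carrier (homology_group q (slab S'))
      \<subseteq> hom_induced q (slab S) {} (slab S') {} id ` carrier (homology_group q (slab S))"
    by (intro subsetI) (rule image_eqI, rule sym, assumption, rule hom_induced_carrier)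
  then show ?thesis
    by (intro subset_antisym image_subsetI hom_induced_carrier)
qed

lemma torsion_free_homology_slab:
  assumes X: "torsion_free_homology X"
    and h: "homotopic_with_canon (\<lambda>_. True) S S id (\<lambda>_. a)" and a: "a \<in> S"
  shows "torsion_free_homology (slab S)"
proof (rule torsion_free_homology_dominated [OF X])
  show "continuous_map (slab S) X fst"
    by (simp add: continuous_map_fst)
  show "continuous_map X (slab S) (\<lambda>x. (x, a))"
    using a by (simp add: continuous_map_pairwise o_def)
  show "homotopic_with (\<lambda>_. True) (slab S) (slab S) ((\<lambda>x. (x, a)) \<circ> fst) id"
    using homotopic_slab [OF h] by (simp add: case_prod_unfold o_def)
qed


text \<open>The upper half \<open>?T\<close> is open and closed, so it can be excised from its own
  pair: the relative group is the homology of the lower half. Both halves have a contractible second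
  factor.\<close>

lemma torsion_free_homology_slab_halfplanes:
  assumes X: "torsion_free_homology X"
  shows "torsion_free_homology (slab {z. Im z \<noteq> 0})"
proof -
  let ?E = "slab {z. Im z \<noteq> 0}" and ?U = "{z. Im z > 0}" and ?L = "{z. Im z < 0}"
  let ?T = "topspace X \<times> ?U"
  have U: "subtopology ?E ?T = slab ?U"
    unfolding slab_subtopology by (rule arg_cong [of _ _ slab]) auto
  have hU: "homotopic_with_canon (\<lambda>_. True) ?U ?U id (\<lambda>_. \<i>)"
    by (rule homotopic_canon_starlike [of _ \<i>]) (auto simp: closed_segment_subset convex_halfspace_Im_gt)
  have hL: "homotopic_with_canon (\<lambda>_. True) ?L ?L id (\<lambda>_. -\<i>)"
    by (rule homotopic_canon_starlike [of _ "-\<i>"]) (auto simp: closed_segment_subset convex_halfspace_Im_lt)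
  show ?thesis
  proof (rule torsion_free_homology_extension [of _ ?T])
    show "torsion_free_homology (subtopology ?E ?T)"
      unfolding U by (rule torsion_free_homology_slab [OF X hU]) auto
    show "inj_on (hom_induced q (subtopology ?E ?T) {} ?E {} id)
            (carrier (homology_group q (subtopology ?E ?T)))" for q
      unfolding U by (rule inj_on_slab [OF hU]) auto
    show "torsion_free_group (relative_homology_group q ?E ?T)" for q
    proof (rule torsion_free_relative_homology_excision)
      have o: "openin ?E ?T"
        unfolding openin_prod_Times_iff
        by (intro disjI2 conjI open_subset) (auto intro!: open_Collect_less continuous_intros)
      have "openin ?E (topspace X \<times> ?L)"
        unfolding openin_prod_Times_iff
        by (intro disjI2 conjI open_subset) (auto intro!: open_Collect_less continuous_intros)
      moreover have "topspace ?E - ?T = topspace X \<times> ?L"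
        by auto
      ultimately have "openin ?E (topspace ?E - ?T)"
        by (simp only:)
      moreover have sub: "?T \<subseteq> topspace ?E"
        by auto
      ultimately have "closedin ?E ?T"
        unfolding closedin_def by blast
      then show "Abstract_Topology.closure_of ?E ?T \<subseteq> Abstract_Topology.interior_of ?E ?T"
        using o by (simp add: closure_of_closedin interior_of_openin)
      show "?T \<subseteq> topspace ?E"
        by (rule sub)
      have "subtopology ?E (topspace ?E - ?T) = slab ?L"
        unfolding \<open>topspace ?E - ?T = _\<close> slab_subtopology by (rule arg_cong [of _ _ slab]) auto
      moreover have "torsion_free_homology (slab ?L)"
        by (rule torsion_free_homology_slab [OF X hL]) auto
      ultimately show "torsion_free_group (relative_homology_group q (subtopology ?E (topspace ?E - ?T)) (?T - ?T))"
        by (simp add: torsion_free_homology_def)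
    qed
  qed
qed

text \<open>The subspace \<open>?T\<close> removes the nonpositive ray and has a contractible second
  factor. Excising the positive ray \<open>?K\<close> from the pair leaves the plane without the
  nonnegative ray, relative to the two open half-planes. The former is again contractible, so
  classes of the half-planes cover its homology and the relative group is torsion-free.\<close>

lemma torsion_free_homology_slab_punctured_plane:
  assumes X: "torsion_free_homology X"
  shows "torsion_free_homology (slab (- {0}))"
proof -
  let ?E = "slab (- {0})" and ?P = "- \<real>\<^sub>\<le>\<^sub>0 :: complex set" and ?N = "- \<real>\<^sub>\<ge>\<^sub>0 :: complex set"
  let ?T = "topspace X \<times> ?P" and ?K = "topspace X \<times> {z. Im z = 0 \<and> Re z > 0}"
  have T: "subtopology ?E ?T = slab ?P"
    unfolding slab_subtopology by (rule arg_cong [of _ _ slab]) (auto simp: complex_nonpos_Reals_iff)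
  have hP: "homotopic_with_canon (\<lambda>_. True) ?P ?P id (\<lambda>_. 1)"
  proof -
    have "complex_of_real ` {..0} = \<real>\<^sub>\<le>\<^sub>0"
      by (auto simp: nonpos_Reals_def)
    then obtain a where "\<And>z. z \<in> ?P \<Longrightarrow> closed_segment a z \<subseteq> ?P"
      using starlike_slotted_complex_plane_left [of 0] unfolding starlike_def by metis
    then show ?thesis
      by (rule homotopic_canon_starlike) auto
  qed
  have hN: "homotopic_with_canon (\<lambda>_. True) ?N ?N id (\<lambda>_. \<i>)"
  proof -
    have "complex_of_real ` {0..} = \<real>\<^sub>\<ge>\<^sub>0"
      by (auto simp: nonneg_Reals_def)
    then obtain a where "\<And>z. z \<in> ?N \<Longrightarrow> closed_segment a z \<subseteq> ?N"
      using starlike_slotted_complex_plane_right [of 0] unfolding starlike_def by metis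
    then show ?thesis
      by (rule homotopic_canon_starlike) (auto simp: complex_nonneg_Reals_iff)
  qed
  show ?thesis
  proof (rule torsion_free_homology_extension [of _ ?T])
    show "torsion_free_homology (subtopology ?E ?T)"
      unfolding T by (rule torsion_free_homology_slab [OF X hP]) auto
    show "inj_on (hom_induced q (subtopology ?E ?T) {} ?E {} id)
            (carrier (homology_group q (subtopology ?E ?T)))" for q
      unfolding T by (rule inj_on_slab [OF hP]) auto
    show "torsion_free_group (relative_homology_group q ?E ?T)" for q
    proof (rule torsion_free_relative_homology_excision)
      have "openin ?E ?T"
        unfolding openin_prod_Times_iff
        by (intro disjI2 conjI open_subset) (auto simp: complex_nonpos_Reals_iff)
      moreover have "closedin ?E ?K"
      proof -
        have "{z. Im z = 0 \<and> Re z > 0} = - {0} \<inter> (\<real>\<^sub>\<ge>\<^sub>0 :: complex set)"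
          by (auto simp: complex_nonneg_Reals_iff complex_eq_iff)
        then have "closedin (top_of_set (- {0})) {z. Im z = 0 \<and> Re z > 0}"
          using closedin_closed_Int [OF closed_nonneg_Reals_complex] by simp
        then show ?thesis
          by (simp add: closedin_prod_Times_iff)
      qed
      moreover have "?K \<subseteq> ?T"
        by (auto simp: complex_nonpos_Reals_iff)
      ultimately show "Abstract_Topology.closure_of ?E ?K \<subseteq> Abstract_Topology.interior_of ?E ?T"
        by (simp add: closure_of_closedin interior_of_openin)
      show "?T \<subseteq> topspace ?E"
        by auto
      have "topspace ?E - ?K = topspace X \<times> ?N"
        by (auto simp: complex_nonneg_Reals_iff complex_eq_iff)
      moreover have "subtopology ?E (topspace X \<times> ?N) = slab ?N"
        unfolding slab_subtopology by (rule arg_cong [of _ _ slab]) (auto simp: complex_nonneg_Reals_iff)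
      moreover have TK: "?T - ?K = topspace X \<times> {z. Im z \<noteq> 0}"
        by (auto simp: complex_nonpos_Reals_iff)
      moreover have "torsion_free_group (relative_homology_group q (slab ?N) (topspace X \<times> {z. Im z \<noteq> 0}))"
      proof (rule torsion_free_relative_homology)
        have H: "subtopology (slab ?N) (topspace X \<times> {z. Im z \<noteq> 0}) = slab {z. Im z \<noteq> 0}"
          unfolding slab_subtopology by (rule arg_cong [of _ _ slab]) (auto simp: complex_nonneg_Reals_iff)
        show "torsion_free_homology (subtopology (slab ?N) (topspace X \<times> {z. Im z \<noteq> 0}))"
          unfolding H using X by (rule torsion_free_homology_slab_halfplanes)
        show "hom_induced q (subtopology (slab ?N) (topspace X \<times> {z. Im z \<noteq> 0})) {} (slab ?N) {} id `
           carrier (homology_group q (subtopology (slab ?N) (topspace X \<times> {z. Im z \<noteq> 0}))) =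
           carrier (homology_group q (slab ?N))" for q
          unfolding H by (rule surj_slab [OF hN]) (auto simp: complex_nonneg_Reals_iff)
      qed
      ultimately show "torsion_free_group (relative_homology_group q (subtopology ?E (topspace ?E - ?K)) (?T - ?K))"
        by simp
    qed
  qed
qed

end

section \<open>Complements of homeomorphic closed sets and Alexander duality\<close>

lemma torsion_free_homology_homeomorphic:
  assumes "X homeomorphic_space Y" "torsion_free_homology Y"
  shows "torsion_free_homology X"
  unfolding torsion_free_homology_def
proof
  fix q
  show "torsion_free_group (homology_group q X)"
    by (rule torsion_free_group_iso [OF _ _ homeomorphic_space_imp_isomorphic_homology_groups [OF assms(1)]])
      (simp_all add: torsion_free_homologyD [OF assms(2)])
qed

text \<open>A linear model \<open>g\<close> of the space as \<open>Euclidean_space\<close>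
  transports the sets to where duality applies: homeomorphic closed subsets there have complements
  with isomorphic homology.\<close>

lemma torsion_free_homology_complement:
  fixes S T :: "'a::euclidean_space set"
  assumes "closed S" "closed T" and ST: "S homeomorphic T"
    and T: "torsion_free_homology (top_of_set (- T))"
  shows "torsion_free_homology (top_of_set (- S))"
proof -
  let ?E = "Euclidean_space (DIM('a))"
  obtain f g where "homeomorphic_maps ?E (euclidean :: 'a topology) f g"
    using homeomorphic_maps_Euclidean_space_euclidean by blast
  then have g: "homeomorphic_map euclidean ?E g"
    by (metis homeomorphic_map_maps homeomorphic_maps_sym)
  have inj: "inj g" and surj: "range g = topspace ?E"
    using g by (auto simp: homeomorphic_eq_everything_map inj_on_def)
  have compl: "g ` (- A) = topspace ?E - g ` A" for A
    using inj surj by (metis Compl_eq_Diff_UNIV image_set_diff)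
  have sub: "top_of_set A homeomorphic_space subtopology ?E (g ` A)" for A
  proof -
    have "homeomorphic_map (top_of_set A) (subtopology ?E (g ` A)) g"
      using surj by (intro homeomorphic_map_subtopologies [OF g]) auto
    then show ?thesis
      by (rule homeomorphic_map_imp_homeomorphic_space)
  qed
  have cl: "closedin ?E (g ` A)" if "closed A" for A
    using that homeomorphic_map_closedness [OF g, of A] by simp
  have "subtopology ?E (g ` S) homeomorphic_space subtopology ?E (g ` T)"
    using sub ST by (metis homeomorphic_space_iff_homeomorphic homeomorphic_space_sym homeomorphic_space_trans)
  from isomorphic_homology_groups_Euclidean_complements [OF cl cl this] assms(1,2)
  have iso: "homology_group q (subtopology ?E (g ` (- S))) \<cong> homology_group q (subtopology ?E (g ` (- T)))" for q
    by (simp add: compl)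
  have "torsion_free_homology (subtopology ?E (g ` (- T)))"
    using torsion_free_homology_homeomorphic [OF _ T] sub homeomorphic_space_sym by blast
  then have "torsion_free_homology (subtopology ?E (g ` (- S)))"
    using torsion_free_group_iso [OF group_relative_homology_group group_relative_homology_group iso]
    by (simp add: torsion_free_homology_def)
  with sub show ?thesis
    by (rule torsion_free_homology_homeomorphic)
qed

lemma torsion_free_homology_punctured_plane:
  "torsion_free_homology (top_of_set (- {0} :: complex set))"
proof (rule torsion_free_homology_dominated)
  let ?P = "top_of_set {0::complex}"
  show "torsion_free_homology (prod_topology ?P (top_of_set (- {0} :: complex set)))"
    by (intro torsion_free_homology_slab_punctured_plane torsion_free_homology_singleton) simp
  show "continuous_map (top_of_set (- {0} :: complex set)) (prod_topology ?P (top_of_set (- {0}))) (\<lambda>z. (0, z))"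
  proof -
    have "continuous_on (- {0}) (\<lambda>z::complex. (0::complex, z))"
      by (intro continuous_intros)
    then show ?thesis
      by simp
  qed
  show "continuous_map (prod_topology ?P (top_of_set (- {0} :: complex set))) (top_of_set (- {0})) snd"
    by (auto intro!: continuous_intros)
  show "homotopic_with (\<lambda>_. True) (top_of_set (- {0} :: complex set)) (top_of_set (- {0})) (snd \<circ> (\<lambda>z. (0::complex, z))) id"
    by (simp add: o_def id_def)
qed

text \<open>By Alexander duality only the homeomorphism type of the two curves matters, so the
  tangent curve \<open>x = y\<^sup>p\<close> may be replaced by the transverse line \<open>y = 0\<close>.\<close>

lemma homeomorphic_tangent_curves:
  fixes p :: nat
  assumes p: "p > 0"
  shows "{(x :: complex, y :: complex). x = 0 \<or> x = y ^ p} homeomorphic {(x :: complex, y :: complex). x = 0 \<or> y = 0}"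
proof -
  let ?S1 = "{(x :: complex, y :: complex). x = 0}" and ?S2 = "{(x, y :: complex). x = y ^ p}"
    and ?T2 = "{(x :: complex, y :: complex). y = 0}"
  \<comment> \<open>The two curves meet only at the origin, where both branches agree. Off the line
    \<open>x = 0\<close> the coordinate \<open>y\<close> parametrizes the curve
    \<open>x = y ^ p\<close>, and \<open>k\<close> undoes this.\<close>
  define h where "h = (\<lambda>v :: complex \<times> complex. if fst v = 0 then (0, snd v) else (snd v, 0))"
  define k where "k = (\<lambda>v :: complex \<times> complex. if fst v = 0 then (0, snd v) else (fst v ^ p, fst v))"
  have cl: "closed ?S1" "closed ?S2" "closed ?T2"
    unfolding case_prod_unfold by - (intro closed_Collect_eq continuous_intros)+
  have h: "continuous_on (?S1 \<union> ?S2) h"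
    unfolding h_def using p by (intro continuous_on_cases cl) (auto intro!: continuous_intros simp: case_prod_unfold)
  have k: "continuous_on (?S1 \<union> ?T2) k"
    unfolding k_def using p by (intro continuous_on_cases cl) (auto intro!: continuous_intros simp: case_prod_unfold)
  have S: "{(x :: complex, y :: complex). x = 0 \<or> x = y ^ p} = ?S1 \<union> ?S2"
    and T: "{(x :: complex, y :: complex). x = 0 \<or> y = 0} = ?S1 \<union> ?T2"
    by auto
  show ?thesis
    unfolding S T
  proof (rule homeomorphicI [OF _ _ h k])
    show "h ` (?S1 \<union> ?S2) = ?S1 \<union> ?T2"
    proof
      show "?S1 \<union> ?T2 \<subseteq> h ` (?S1 \<union> ?S2)"
      proof
        fix v assume v: "v \<in> ?S1 \<union> ?T2"
        then have *: "h (k v) = v" and **: "k v \<in> ?S1 \<union> ?S2"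
          using p by (auto simp: h_def k_def)
        show "v \<in> h ` (?S1 \<union> ?S2)"
          by (metis * ** imageI)
      qed
    qed (use p in \<open>auto simp: h_def k_def split: if_splits\<close>)
    show "k ` (?S1 \<union> ?T2) = ?S1 \<union> ?S2"
    proof
      show "?S1 \<union> ?S2 \<subseteq> k ` (?S1 \<union> ?T2)"
      proof
        fix v assume v: "v \<in> ?S1 \<union> ?S2"
        then have *: "k (h v) = v" and **: "h v \<in> ?S1 \<union> ?T2"
          using p by (auto simp: h_def k_def)
        show "v \<in> k ` (?S1 \<union> ?T2)"
          by (metis * ** imageI)
      qed
    qed (use p in \<open>auto simp: h_def k_def split: if_splits\<close>)
  qed (use p in \<open>auto simp: h_def k_def split: if_splits\<close>)
qed

lemma torsion_free_homology_tangent_curves_complement: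
  fixes p :: nat
  assumes p: "p > 0"
  shows "torsion_free_homology (top_of_set {(x, y :: complex). x \<noteq> 0 \<and> x \<noteq> y ^ p})"
proof -
  let ?S = "{(x :: complex, y :: complex). x = 0 \<or> x = y ^ p}" and ?T = "{(x :: complex, y :: complex). x = 0 \<or> y = 0}"
  have "closed ?S" "closed ?T"
    unfolding case_prod_unfold by - (intro closed_Collect_disj closed_Collect_eq continuous_intros)+
  moreover have "- ?T = (- {0}) \<times> (- {0})"
    by auto
  then have "torsion_free_homology (top_of_set (- ?T))"
    using torsion_free_homology_slab_punctured_plane [OF torsion_free_homology_punctured_plane] by simp
  ultimately have "torsion_free_homology (top_of_set (- ?S))"
    using homeomorphic_tangent_curves [OF p] torsion_free_homology_complement by blast
  moreover have "- ?S = {(x, y :: complex). x \<noteq> 0 \<and> x \<noteq> y ^ p}"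
    by auto
  ultimately show ?thesis
    by simp
qed

section \<open>The hypersurface complement\<close>

text \<open>In the coordinates \<open>(x, y, z) = (v\<^sub>i, v\<^sub>j, v\<^sub>k)\<close>, dehomogenizing by \<open>z\<close> turns the complement into
  the product of \<open>\<complex>\<^sup>*\<close> with the complement of the curves \<open>x = 0\<close> and \<open>x = y\<^sup>p\<close>.\<close>

definition torsion_poly :: "nat \<Rightarrow> 'n \<Rightarrow> 'n \<Rightarrow> 'n \<Rightarrow> complex ^ 'n \<Rightarrow> complex"
  where "torsion_poly p i j k v =
    v $ i * (v $ k) ^ (p + 1) * (v $ i * (v $ k) ^ (p - 1) - (v $ j) ^ p)"

lemma homogeneous_torsion_poly:
  fixes i j k :: "'n::finite"
  assumes ijk: "i \<noteq> j" "i \<noteq> k" "j \<noteq> k" and p: "p > 0"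
  shows "homogeneous_polynomial (2 * p + 2) (torsion_poly p i j k)"
proof -
  \<comment> \<open>These are the exponent vectors of the two monomials \<open>x^2 z^(2p)\<close>
    and \<open>x y^p z^(p+1)\<close> of the expanded polynomial.\<close>
  define a where "a = (\<lambda>m. (if m = i then 2 else 0) + (if m = k then 2 * p else 0))"
  define b where "b = (\<lambda>m. (if m = i then 1 else 0) + ((if m = j then p else 0) + (if m = k then p + 1 else 0)))"
  have "a i \<noteq> b i"
    using ijk by (simp add: a_def b_def)
  then have ab: "a \<noteq> b"
    by auto
  have delta: "(\<Prod>m\<in>UNIV. (v $ m) ^ (if m = i then e else 0)) = (v $ i) ^ e" for v :: "complex ^ 'n" and i e
    by (simp add: if_distrib [of "\<lambda>e. _ ^ e"] cong: if_cong)
  have "torsion_poly p i j k v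
      = (\<Sum>e\<in>{a, b}. (if e = a then 1 else -1) * (\<Prod>m\<in>UNIV. (v $ m) ^ e m))" for v
  proof -
    obtain q where q: "p = Suc q"
      using p gr0_implies_Suc by blast
    have "(\<Prod>m\<in>UNIV. (v $ m) ^ a m) = (v $ i) ^ 2 * (v $ k) ^ (2 * p)"
      by (simp add: a_def power_add prod.distrib delta)
    moreover have "(\<Prod>m\<in>UNIV. (v $ m) ^ b m) = v $ i * ((v $ j) ^ p * (v $ k) ^ (p + 1))"
      using delta [of v i 1] by (simp only: b_def power_add prod.distrib delta power_one_right)
    ultimately show ?thesis
      using ab by (simp add: torsion_poly_def q algebra_simps power2_eq_square flip: power_add mult_2)
  qed
  moreover have "\<forall>e\<in>{a, b}. sum e UNIV = 2 * p + 2"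
    by (simp add: a_def b_def sum.distrib)
  ultimately show ?thesis
    unfolding homogeneous_polynomial_def by (intro exI [of _ "{a, b}"] exI) auto
qed

text \<open>The polynomial involves only the coordinates \<open>i\<close>, \<open>j\<close>,
  \<open>k\<close>. The composite \<open>?s \<circ> ?r\<close> keeps these and sets all others to 0,
  so the straight segment from it to the identity never leaves the complement.\<close>

lemma torsion_free_homology_torsion_poly_complement:
  fixes i j k :: "'n::finite"
  assumes ijk: "i \<noteq> j" "i \<noteq> k" "j \<noteq> k" and p: "p > 0"
  shows "torsion_free_homology (top_of_set (hypersurface_complement (torsion_poly p i j k)))"
proof (rule torsion_free_homology_dominated)
  let ?M = "hypersurface_complement (torsion_poly p i j k)"
  let ?U = "{(x, y :: complex). x \<noteq> 0 \<and> x \<noteq> y ^ p}"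
  let ?r = "\<lambda>v :: complex ^ 'n. ((v $ i / v $ k, v $ j / v $ k), v $ k)"
  let ?s = "\<lambda>((x, y), z). \<chi> m. if m = i then x * z else if m = j then y * z else if m = k then z else (0 :: complex)"
  have M: "v \<in> ?M \<longleftrightarrow> v $ i \<noteq> 0 \<and> v $ k \<noteq> 0 \<and> v $ i * (v $ k) ^ (p - 1) \<noteq> (v $ j) ^ p" for v
    using p by (auto simp: hypersurface_complement_def torsion_poly_def)
  have pw: "z ^ p = z * z ^ (p - 1)" for z :: complex
    using p by (simp add: power_eq_if)
  show "torsion_free_homology (prod_topology (top_of_set ?U) (top_of_set (- {0} :: complex set)))"
    using p by (intro torsion_free_homology_slab_punctured_plane torsion_free_homology_tangent_curves_complement)
  have r: "?r v \<in> ?U \<times> (- {0})" if "v \<in> ?M" for v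
    using that by (auto simp: M pw [of "v $ k"] power_divide field_simps)
  show "continuous_map (top_of_set ?M) (prod_topology (top_of_set ?U) (top_of_set (- {0}))) ?r"
    using r by (auto simp: M intro!: continuous_intros)
  have s: "?s w \<in> ?M" if "w \<in> ?U \<times> (- {0})" for w
    using that ijk by (auto simp: M pw power_mult_distrib)
  have cs: "continuous_on (?U \<times> (- {0})) ?s"
  proof -
    have "continuous_on A (\<lambda>w. if m = i then fst (fst w) * snd w else if m = j then snd (fst w) * snd w
            else if m = k then snd w else (0 :: complex))" for A m
      by (cases "m = i"; cases "m = j"; cases "m = k") (simp_all add: continuous_intros)
    then show ?thesis
      unfolding case_prod_unfold by (intro continuous_on_vec_lambda) 
  qed
  then show "continuous_map (prod_topology (top_of_set ?U) (top_of_set (- {0}))) (top_of_set ?M) ?s"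
    using s by auto
  show "homotopic_with_canon (\<lambda>_. True) ?M ?M (?s \<circ> ?r) id"
  proof (rule homotopic_with_linear)
    have "continuous_on ?M ?r"
      by (auto simp: M intro!: continuous_intros)
    then show "continuous_on ?M (?s \<circ> ?r)"
      using r by (intro continuous_on_compose continuous_on_subset [OF cs]) blast+
    show "closed_segment ((?s \<circ> ?r) v) (id v) \<subseteq> ?M" if "v \<in> ?M" for v
    proof
      fix w assume "w \<in> closed_segment ((?s \<circ> ?r) v) (id v)"
      then obtain u where w: "w = (1 - u) *\<^sub>R ?s (?r v) + u *\<^sub>R v"
        by (auto simp: in_segment)
      have "w $ m = v $ m" if "m \<in> {i, j, k}" for m
        using that \<open>v \<in> ?M\<close> ijk by (auto simp: w M algebra_simps)
      then show "w \<in> ?M"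
        using that by (simp add: M)
    qed
  qed auto
qed

section \<open>Winding numbers of singular chains\<close>

definition chain_sum :: "('b \<Rightarrow> complex) \<Rightarrow> ('b \<Rightarrow>\<^sub>0 int) \<Rightarrow> complex"
  where "chain_sum \<phi> c = (\<Sum>\<sigma>\<in>Poly_Mapping.keys c. of_int (Poly_Mapping.lookup c \<sigma>) * \<phi> \<sigma>)"

lemma chain_sum_superset:
  assumes "finite S" "Poly_Mapping.keys c \<subseteq> S"
  shows "chain_sum \<phi> c = (\<Sum>\<sigma>\<in>S. of_int (Poly_Mapping.lookup c \<sigma>) * \<phi> \<sigma>)"
  unfolding chain_sum_def using assms by (intro sum.mono_neutral_left) (auto simp: in_keys_iff)

lemma chain_sum_0 [simp]: "chain_sum \<phi> 0 = 0"
  by (simp add: chain_sum_def)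

lemma chain_sum_frag_of [simp]: "chain_sum \<phi> (frag_of \<sigma>) = \<phi> \<sigma>"
  by (simp add: chain_sum_def)

lemma chain_sum_add: "chain_sum \<phi> (a + b) = chain_sum \<phi> a + chain_sum \<phi> b"
proof -
  let ?S = "Poly_Mapping.keys a \<union> Poly_Mapping.keys b"
  have "chain_sum \<phi> c = (\<Sum>\<sigma>\<in>?S. of_int (Poly_Mapping.lookup c \<sigma>) * \<phi> \<sigma>)"
    if "c \<in> {a, b, a + b}" for c
    using that Poly_Mapping.keys_add [of a b] by (intro chain_sum_superset) auto
  then show ?thesis
    by (simp add: lookup_add sum.distrib distrib_right)
qed

lemma chain_sum_minus: "chain_sum \<phi> (- a) = - chain_sum \<phi> a"
  by (simp add: chain_sum_def sum_negf)

lemma chain_sum_diff: "chain_sum \<phi> (a - b) = chain_sum \<phi> a - chain_sum \<phi> b"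
  using chain_sum_add [of \<phi> a "- b"] by (simp add: chain_sum_minus)

lemma chain_sum_extend:
  "chain_sum \<phi> (frag_extend b c) = chain_sum (\<lambda>\<sigma>. chain_sum \<phi> (b \<sigma>)) c"
  using subset_UNIV [of "Poly_Mapping.keys c"]
  by (induction c rule: frag_induction) (auto simp: chain_sum_diff frag_extend_diff)

lemma chain_sum_distrib:
  "chain_sum (\<lambda>\<sigma>. \<phi> \<sigma> + \<psi> \<sigma>) c = chain_sum \<phi> c + chain_sum \<psi> c"
  by (simp add: chain_sum_def distrib_left sum.distrib)

lemma chain_sum_mult_left:
  "chain_sum (\<lambda>\<sigma>. a * \<phi> \<sigma>) c = a * chain_sum \<phi> c"
  by (simp add: chain_sum_def sum_distrib_left mult_ac)

lemma chain_sum_cong: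
  "(\<And>\<sigma>. \<sigma> \<in> Poly_Mapping.keys c \<Longrightarrow> \<phi> \<sigma> = \<psi> \<sigma>) \<Longrightarrow> chain_sum \<phi> c = chain_sum \<psi> c"
  by (simp add: chain_sum_def)

lemma chain_boundary_1_of:
  "chain_boundary 1 (frag_of \<sigma>) = frag_of (singular_face 1 0 \<sigma>) - frag_of (singular_face 1 1 \<sigma>)"
  by (simp add: chain_boundary_of)

lemma chain_boundary_2_of:
  "chain_boundary 2 (frag_of \<sigma>)
     = frag_of (singular_face 2 0 \<sigma>) - frag_of (singular_face 2 1 \<sigma>) + frag_of (singular_face 2 2 \<sigma>)"
  by (simp add: chain_boundary_of numeral_2_eq_2)

text \<open>Reduces an identity about boundaries of chains to boundaries of single
  simplices.\<close>

lemma chain_sum_boundary: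
  assumes "p > 0"
  shows "chain_sum \<phi> (chain_boundary p c) = chain_sum (\<lambda>\<sigma>. chain_sum \<phi> (chain_boundary p (frag_of \<sigma>))) c"
  using assms by (simp add: chain_boundary_def chain_sum_extend)

section \<open>Continuous logarithms along paths\<close>

definition log_increment :: "(real \<Rightarrow> complex) \<Rightarrow> complex"
  where "log_increment g = (SOME d. \<exists>L. continuous_on {0..1} L \<and>
           (\<forall>t\<in>{0..1}. g t = exp (L t)) \<and> d = L 1 - L 0)"

text \<open>Makes the choice in \<open>log_increment\<close> harmless: two continuous logarithms
  differ by a continuous function with values in the discrete set of multiples of 2 pi \<i>, which
  is constant on the interval.\<close>

lemma log_increment_eq:
  assumes L: "continuous_on {0..1} L" "\<And>t. t \<in> {0..1} \<Longrightarrow> g t = exp (L t)"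
  shows "log_increment g = L 1 - L 0"
proof -
  have "\<exists>L'. continuous_on {0..1} L' \<and> (\<forall>t\<in>{0..1}. g t = exp (L' t)) \<and> log_increment g = L' 1 - L' 0"
    unfolding log_increment_def by (rule someI_ex) (use L in blast)
  then obtain L' where L': "continuous_on {0..1} L'" "\<And>t. t \<in> {0..1} \<Longrightarrow> g t = exp (L' t)"
    "log_increment g = L' 1 - L' 0"
    by blast
  let ?D = "\<lambda>t. L t - L' t"
  have exp1: "exp (?D t) = 1" if "t \<in> {0..1}" for t
    using L(2) [OF that] L'(2) [OF that] by (simp add: exp_diff)
  have "?D constant_on {0..1}"
  proof (rule continuous_discrete_range_constant)
    show "continuous_on {0..1} ?D"
      by (intro continuous_intros L L')
    show "\<exists>e>0. \<forall>s. s \<in> {0..1} \<and> ?D s \<noteq> ?D t \<longrightarrow> e \<le> norm (?D s - ?D t)" if t: "t \<in> {0..1}" for t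
    \<comment> \<open>Distinct multiples of 2 pi \<i> are at least 2 pi apart, so a gap of 1
      suffices.\<close>
    proof (intro exI [of _ "1::real"] conjI allI impI)
      fix s :: real assume s: "s \<in> {0..1} \<and> ?D s \<noteq> ?D t"
      obtain m n :: int where "?D s = of_real (2 * m * pi) * \<i>" "?D t = of_real (2 * n * pi) * \<i>"
        using exp1 [of s] exp1 [OF t] s unfolding exp_eq_1 by (auto simp: complex_eq_iff)
      then have eq: "?D s - ?D t = of_real (2 * pi * of_int (m - n)) * \<i>"
        by (simp add: algebra_simps)
      with s have "m \<noteq> n"
        by auto
      then have "1 \<le> \<bar>real_of_int (m - n)\<bar>"
        by linarith
      moreover have "1 \<le> 2 * pi"
        using pi_ge_two by linarith
      ultimately have "1 * 1 \<le> (2 * pi) * \<bar>real_of_int (m - n)\<bar>"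
        by (intro mult_mono) auto
      then show "1 \<le> norm (?D s - ?D t)"
        unfolding eq norm_mult norm_of_real by (simp add: abs_mult)
    qed auto
  qed auto
  then have "?D 1 = ?D 0"
    unfolding constant_on_def by (metis atLeastAtMost_iff zero_le_one order_refl)
  then have "L 1 - L 0 = L' 1 - L' 0"
    by (simp add: algebra_simps)
  then show ?thesis
    using L'(3) by simp
qed

lemma continuous_log_path:
  fixes g :: "real \<Rightarrow> complex"
  assumes "continuous_on {0..1} g" "\<And>t. t \<in> {0..1} \<Longrightarrow> g t \<noteq> 0"
  obtains L where "continuous_on {0..1} L" "\<And>t. t \<in> {0..1} \<Longrightarrow> g t = exp (L t)"
  using continuous_logarithm_on_contractible [OF assms(1)] assms(2) by (metis convex_imp_contractible convex_real_interval(5))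

text \<open>Standard simplices consist of functions of barycentric coordinates.
  \<open>edge_point\<close> and \<open>triangle_point\<close> parametrize them by an interval and by
  a planar triangle, where continuous logarithms are available; vertex 0 corresponds to the
  origin.\<close>

definition edge_point :: "real \<Rightarrow> nat \<Rightarrow> real"
  where "edge_point t = (\<lambda>i. if i = 0 then 1 - t else if i = 1 then t else 0)"

definition triangle_point :: "real \<times> real \<Rightarrow> nat \<Rightarrow> real"
  where "triangle_point w = (\<lambda>i. if i = 0 then 1 - fst w - snd w else if i = 1 then fst w
     else if i = 2 then snd w else 0)"

lemma edge_point_in_simplex: "t \<in> {0..1} \<Longrightarrow> edge_point t \<in> standard_simplex 1"
  by (auto simp: edge_point_def standard_simplex_def)

lemma triangle_point_in_simplex:
  "0 \<le> fst w \<Longrightarrow> 0 \<le> snd w \<Longrightarrow> fst w + snd w \<le> 1 \<Longrightarrow> triangle_point w \<in> standard_simplex 2"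
  by (auto simp: triangle_point_def standard_simplex_def numeral_2_eq_2)

lemma singular_face_1_edge:
  assumes "v \<in> standard_simplex 0"
  shows "singular_face 1 0 \<sigma> v = \<sigma> (edge_point 1)" "singular_face 1 1 \<sigma> v = \<sigma> (edge_point 0)"
proof -
  have v: "v = (\<lambda>j. if j = 0 then 1 else 0)"
    using assms by (simp add: standard_simplex_0)
  have "simplical_face 0 v = edge_point 1" "simplical_face 1 v = edge_point 0"
    by (auto simp: simplical_face_def edge_point_def v fun_eq_iff)
  then show "singular_face 1 0 \<sigma> v = \<sigma> (edge_point 1)" "singular_face 1 1 \<sigma> v = \<sigma> (edge_point 0)"
    using assms by (simp_all add: singular_face_def)
qed

lemma singular_face_2_triangle:
  assumes "t \<in> {0..1}"
  shows "singular_face 2 0 \<sigma> (edge_point t) = \<sigma> (triangle_point (1 - t, t))"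
    and "singular_face 2 1 \<sigma> (edge_point t) = \<sigma> (triangle_point (0, t))"
    and "singular_face 2 2 \<sigma> (edge_point t) = \<sigma> (triangle_point (t, 0))"
proof -
  have e: "edge_point t \<in> standard_simplex (2 - Suc 0)"
    using edge_point_in_simplex [OF assms] by simp
  have "simplical_face 0 (edge_point t) = triangle_point (1 - t, t)"
    "simplical_face 1 (edge_point t) = triangle_point (0, t)"
    "simplical_face 2 (edge_point t) = triangle_point (t, 0)"
    by (auto simp: simplical_face_def edge_point_def triangle_point_def fun_eq_iff)
  then show "singular_face 2 0 \<sigma> (edge_point t) = \<sigma> (triangle_point (1 - t, t))"
     "singular_face 2 1 \<sigma> (edge_point t) = \<sigma> (triangle_point (0, t))"
     "singular_face 2 2 \<sigma> (edge_point t) = \<sigma> (triangle_point (t, 0))"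
    using e by (simp_all add: singular_face_def)
qed

lemma continuous_map_into_simplex:
  fixes S :: "'a::topological_space set"
  assumes "\<And>i. continuous_on S (\<lambda>x. f x i)" "\<And>x. x \<in> S \<Longrightarrow> f x \<in> standard_simplex n"
  shows "continuous_map (top_of_set S) (subtopology (powertop_real UNIV) (standard_simplex n)) f"
  using assms by (auto simp: continuous_map_in_subtopology continuous_map_componentwise_UNIV)

lemma continuous_on_singular_simplex:
  assumes \<sigma>: "singular_simplex n X \<sigma>" and u: "continuous_map X euclidean u"
    and f: "\<And>i. continuous_on S (\<lambda>x. f x i)" "\<And>x. x \<in> S \<Longrightarrow> f x \<in> standard_simplex n"
  shows "continuous_on S (\<lambda>x. u (\<sigma> (f x)))"
proof -
  have "continuous_map (top_of_set S) euclidean (u \<circ> (\<sigma> \<circ> f))"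
    using continuous_map_into_simplex [OF f] \<sigma> u
    by (intro continuous_map_compose) (auto simp: singular_simplex_def)
  then show ?thesis
    by (simp add: o_def)
qed

lemma singular_simplex_in_topspace:
  "singular_simplex n X \<sigma> \<Longrightarrow> x \<in> standard_simplex n \<Longrightarrow> \<sigma> x \<in> topspace X"
  by (auto simp: singular_simplex_def continuous_map_def)

text \<open>The continuous counterpart of the integral of \<open>du / u\<close> over the chain, so
  that cycles give integer multiples of 2 pi \<i>.\<close>

definition winding :: "('a \<Rightarrow> complex) \<Rightarrow> 'a chain \<Rightarrow> complex"
  where "winding u c = chain_sum (\<lambda>\<sigma>. log_increment (\<lambda>t. u (\<sigma> (edge_point t)))) c"

lemma winding_diff: "winding u (a - b) = winding u a - winding u b"
  by (simp add: winding_def chain_sum_diff)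

definition nonvanishing_on :: "'a topology \<Rightarrow> ('a \<Rightarrow> complex) \<Rightarrow> bool"
  where "nonvanishing_on X u \<longleftrightarrow> continuous_map X euclidean u \<and> (\<forall>x\<in>topspace X. u x \<noteq> 0)"

lemma nonvanishing_log_path:
  assumes u: "nonvanishing_on X u" and \<sigma>: "singular_simplex 1 X \<sigma>"
  obtains L where "continuous_on {0..1} L" "\<And>t. t \<in> {0..1} \<Longrightarrow> u (\<sigma> (edge_point t)) = exp (L t)"
proof (rule continuous_log_path)
  show "continuous_on {0..1} (\<lambda>t. u (\<sigma> (edge_point t)))"
  proof (rule continuous_on_singular_simplex [OF \<sigma> _ _ edge_point_in_simplex])
    show "continuous_on {0..1} (\<lambda>t. edge_point t i)" for i
      unfolding edge_point_def by (cases "i = 0"; cases "i = 1") (simp_all add: continuous_intros)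
  qed (use u in \<open>auto simp: nonvanishing_on_def\<close>)
  show "u (\<sigma> (edge_point t)) \<noteq> 0" if "t \<in> {0..1}" for t
    using u singular_simplex_in_topspace [OF \<sigma> edge_point_in_simplex [OF that]]
    by (auto simp: nonvanishing_on_def)
qed (use that in blast)

text \<open>On a singular triangle the function has a logarithm \<open>L\<close> on the whole
  contractible domain, and the increments of \<open>L\<close> along the three edges cancel with the
  signs of the boundary.\<close>

lemma winding_boundary:
  assumes u: "nonvanishing_on X u" and c: "singular_relboundary 1 X {} c"
  shows "winding u c = 0"
proof -
  obtain d where d: "singular_chain 2 X d" "c = chain_boundary 2 d"
    using c by (auto simp: singular_boundary numeral_2_eq_2)
  have "winding u (chain_boundary 2 (frag_of \<sigma>)) = 0" if "\<sigma> \<in> Poly_Mapping.keys d" for \<sigma>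
  proof -
    have \<sigma>: "singular_simplex 2 X \<sigma>"
      using d that by (auto simp: singular_chain_def)
    let ?T = "{w :: real \<times> real. 0 \<le> fst w \<and> 0 \<le> snd w \<and> fst w + snd w \<le> 1}"
    have cont: "continuous_on ?T (\<lambda>w. u (\<sigma> (triangle_point w)))"
    proof (rule continuous_on_singular_simplex [OF \<sigma>])
      show "continuous_on ?T (\<lambda>w. triangle_point w i)" for i
        unfolding triangle_point_def
        by (cases "i = 0"; cases "i = 1"; cases "i = 2") (simp_all add: continuous_intros)
    qed (use u in \<open>auto simp: nonvanishing_on_def triangle_point_in_simplex\<close>)
    have contr: "contractible ?T"
    proof -
      have "?T = {w. (-1, 0) \<bullet> w \<le> 0} \<inter> {w. (0, -1) \<bullet> w \<le> 0} \<inter> {w. (1, 1) \<bullet> w \<le> 1}"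
        by (auto simp: inner_prod_def)
      then have "convex ?T"
        by (simp only: convex_Int convex_halfspace_le)
      then show ?thesis
        by (rule convex_imp_contractible)
    qed
    have nz: "u (\<sigma> (triangle_point w)) \<noteq> 0" if "w \<in> ?T" for w
      using u singular_simplex_in_topspace [OF \<sigma> triangle_point_in_simplex] that
      by (auto simp: nonvanishing_on_def)
    obtain L where L: "continuous_on ?T L" "\<And>w. w \<in> ?T \<Longrightarrow> u (\<sigma> (triangle_point w)) = exp (L w)"
    proof (rule continuous_logarithm_on_contractible [OF cont contr])
      show "u (\<sigma> (triangle_point w)) \<noteq> 0" if "w \<in> ?T" for w
        using that by (rule nz)
    qed (rule that)
    have side: "log_increment (\<lambda>t. u (singular_face 2 k \<sigma> (edge_point t))) = L (f 1) - L (f 0)"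
      if "continuous_on {0..1} f" "\<And>t. t \<in> {0..1} \<Longrightarrow> f t \<in> ?T"
        "\<And>t. t \<in> {0..1} \<Longrightarrow> singular_face 2 k \<sigma> (edge_point t) = \<sigma> (triangle_point (f t))" for f k
    proof (rule log_increment_eq)
      show "continuous_on {0..1} (\<lambda>t. L (f t))"
        using that by (intro continuous_on_compose2 [OF L(1)]) auto
      show "u (singular_face 2 k \<sigma> (edge_point t)) = exp (L (f t))" if "t \<in> {0..1}" for t
        by (simp only: that L(2) \<open>t \<in> {0..1} \<Longrightarrow> f t \<in> ?T\<close>
             \<open>t \<in> {0..1} \<Longrightarrow> singular_face 2 k \<sigma> (edge_point t) = \<sigma> (triangle_point (f t))\<close>)
    qed
    \<comment> \<open>Faces 0, 1, 2 are the edges from vertex 1 to 2, from 0 to 2 and from 0 to 1,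
      the vertices being (0,0), (1,0), (0,1) in this order.\<close>
    have "log_increment (\<lambda>t. u (singular_face 2 0 \<sigma> (edge_point t))) = L (1 - 1, 1) - L (1 - 0, 0)"
      by (rule side [of "\<lambda>t. (1 - t, t)"]) (auto intro!: continuous_intros simp: singular_face_2_triangle)
    moreover have "log_increment (\<lambda>t. u (singular_face 2 1 \<sigma> (edge_point t))) = L (0, 1) - L (0, 0)"
      by (rule side [of "\<lambda>t. (0, t)"]) (auto intro!: continuous_intros simp: singular_face_2_triangle simp del: One_nat_def)
    moreover have "log_increment (\<lambda>t. u (singular_face 2 2 \<sigma> (edge_point t))) = L (1, 0) - L (0, 0)"
      by (rule side [of "\<lambda>t. (t, 0)"]) (auto intro!: continuous_intros simp: singular_face_2_triangle)
    ultimately show ?thesis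
      by (simp only: winding_def chain_boundary_2_of chain_sum_add chain_sum_diff chain_sum_frag_of) simp
  qed
  then have "chain_sum (\<lambda>\<sigma>. winding u (chain_boundary 2 (frag_of \<sigma>))) d = chain_sum (\<lambda>\<sigma>. 0) d"
    by (intro chain_sum_cong) auto
  then show ?thesis
    unfolding d(2) winding_def by (subst chain_sum_boundary) (simp_all add: chain_sum_def)
qed

lemma winding_homologous:
  assumes "nonvanishing_on X u" "homologous_rel 1 X {} a b"
  shows "winding u a = winding u b"
  using winding_boundary [OF assms(1), of "a - b"] assms(2)
  by (simp add: homologous_rel_def winding_diff)

text \<open>On each edge the increment is the difference of the principal logarithms at the
  endpoints up to a multiple of 2 pi \<i>. These differences add up to zero over a cycle.\<close>

lemma winding_cycle:
  assumes u: "nonvanishing_on X u" and c: "singular_relcycle 1 X {} c"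
  shows "\<exists>n::int. winding u c = 2 * pi * \<i> * n"
proof -
  \<comment> \<open>\<open>\<Lambda>\<close> reads off \<open>Ln\<close> at the single point of a
    0-simplex. The discontinuity of \<open>Ln\<close> does no harm, since only values at endpoints
    are compared.\<close>
  define \<Lambda> where "\<Lambda> = (\<lambda>\<rho>. Ln (u (\<rho> (\<lambda>j::nat. if j = 0 then 1 else 0::real))))"
  define D where "D = (\<lambda>\<sigma>. Ln (u (\<sigma> (edge_point 1))) - Ln (u (\<sigma> (edge_point 0))))"
  have ch: "singular_chain 1 X c" and bd: "chain_boundary 1 c = 0"
    using c by (auto simp: singular_cycle)
  have v0: "(\<lambda>j::nat. if j = 0 then 1 else 0::real) \<in> standard_simplex 0"
    by simp
  have "chain_sum \<Lambda> (chain_boundary 1 c) = chain_sum D c"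
    by (subst chain_sum_boundary)
      (simp_all only: chain_boundary_1_of chain_sum_diff chain_sum_frag_of \<Lambda>_def D_def singular_face_1_edge [OF v0] zero_less_one)
  then have D0: "chain_sum D c = 0"
    using bd by simp
  have "\<exists>n::int. log_increment (\<lambda>t. u (\<sigma> (edge_point t))) = D \<sigma> + 2 * pi * \<i> * n"
    if "\<sigma> \<in> Poly_Mapping.keys c" for \<sigma>
  proof -
    have \<sigma>: "singular_simplex 1 X \<sigma>"
      using that ch by (auto simp: singular_chain_def)
    obtain L where L: "continuous_on {0..1} L" "\<And>t. t \<in> {0..1} \<Longrightarrow> u (\<sigma> (edge_point t)) = exp (L t)"
      using nonvanishing_log_path [OF u \<sigma>] by blast
    have "exp (L t) = exp (Ln (u (\<sigma> (edge_point t))))" if "t \<in> {0..1}" for t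
      using L(2) [OF that] by simp
    then obtain m n :: int where "L 1 = Ln (u (\<sigma> (edge_point 1))) + of_int (2 * m) * pi * \<i>"
      "L 0 = Ln (u (\<sigma> (edge_point 0))) + of_int (2 * n) * pi * \<i>"
      unfolding exp_eq by (metis atLeastAtMost_iff order_refl zero_le_one)
    then have "L 1 - L 0 = D \<sigma> + 2 * pi * \<i> * (m - n)"
      by (simp add: D_def algebra_simps)
    moreover have "log_increment (\<lambda>t. u (\<sigma> (edge_point t))) = L 1 - L 0"
      using L by (rule log_increment_eq)
    ultimately show ?thesis
      by metis
  qed
  then obtain N where N: "\<And>\<sigma>. \<sigma> \<in> Poly_Mapping.keys c \<Longrightarrow>
      log_increment (\<lambda>t. u (\<sigma> (edge_point t))) = D \<sigma> + 2 * pi * \<i> * of_int (N \<sigma>)"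
    by metis
  have "winding u c = chain_sum (\<lambda>\<sigma>. D \<sigma> + 2 * pi * \<i> * of_int (N \<sigma>)) c"
    unfolding winding_def by (intro chain_sum_cong N)
  also have "\<dots> = 2 * pi * \<i> * chain_sum (\<lambda>\<sigma>. of_int (N \<sigma>)) c"
    by (simp add: chain_sum_distrib chain_sum_mult_left D0)
  also have "\<dots> = 2 * pi * \<i> * of_int (\<Sum>\<sigma>\<in>Poly_Mapping.keys c. Poly_Mapping.lookup c \<sigma> * N \<sigma>)"
    by (simp add: chain_sum_def)
  finally show ?thesis
    by blast
qed

text \<open>Logarithms of \<open>u\<close> and \<open>v\<close> combine to one of \<open>w\<close>.
  On cycles this makes the winding numbers of \<open>w\<close> and \<open>u\<close> congruent modulo
  \<open>n\<close>.\<close>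

lemma winding_mult_power:
  assumes u: "nonvanishing_on X u" and v: "nonvanishing_on X v" and c: "singular_chain 1 X c"
    and w: "\<And>x. x \<in> topspace X \<Longrightarrow> w x = u x * v x ^ n"
  shows "winding w c = winding u c + of_nat n * winding v c"
proof -
  have "log_increment (\<lambda>t. w (\<sigma> (edge_point t))) =
      log_increment (\<lambda>t. u (\<sigma> (edge_point t))) + of_nat n * log_increment (\<lambda>t. v (\<sigma> (edge_point t)))"
    if "\<sigma> \<in> Poly_Mapping.keys c" for \<sigma>
  proof -
    have \<sigma>: "singular_simplex 1 X \<sigma>"
      using that c by (auto simp: singular_chain_def)
    obtain L where L: "continuous_on {0..1} L" "\<And>t. t \<in> {0..1} \<Longrightarrow> u (\<sigma> (edge_point t)) = exp (L t)"
      using nonvanishing_log_path [OF u \<sigma>] by blast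
    obtain K where K: "continuous_on {0..1} K" "\<And>t. t \<in> {0..1} \<Longrightarrow> v (\<sigma> (edge_point t)) = exp (K t)"
      using nonvanishing_log_path [OF v \<sigma>] by blast
    have "log_increment (\<lambda>t. w (\<sigma> (edge_point t))) = (L 1 + of_nat n * K 1) - (L 0 + of_nat n * K 0)"
    proof (rule log_increment_eq)
      show "continuous_on {0..1} (\<lambda>t. L t + of_nat n * K t)"
        by (intro continuous_intros L K)
      show "w (\<sigma> (edge_point t)) = exp (L t + of_nat n * K t)" if "t \<in> {0..1}" for t
        using w [OF singular_simplex_in_topspace [OF \<sigma> edge_point_in_simplex [OF that]]] L(2) [OF that] K(2) [OF that]
        by (simp add: exp_add exp_of_nat_mult)
    qed
    moreover have "log_increment (\<lambda>t. u (\<sigma> (edge_point t))) = L 1 - L 0"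
      using L by (rule log_increment_eq)
    moreover have "log_increment (\<lambda>t. v (\<sigma> (edge_point t))) = K 1 - K 0"
      using K by (rule log_increment_eq)
    ultimately show ?thesis
      by (simp only:) (simp add: algebra_simps)
  qed
  then have "winding w c = chain_sum (\<lambda>\<sigma>. log_increment (\<lambda>t. u (\<sigma> (edge_point t)))
      + of_nat n * log_increment (\<lambda>t. v (\<sigma> (edge_point t)))) c"
    unfolding winding_def by (rule chain_sum_cong)
  then show ?thesis
    by (simp add: winding_def chain_sum_distrib chain_sum_mult_left)
qed

lemma winding_chain_map: "winding u (chain_map 1 h c) = winding (u \<circ> h) c"
proof -
  \<comment> \<open>\<open>simplex_map\<close> is restricted to the simplex, but
    \<open>log_increment\<close> sees the path only over the unit interval, which
    \<open>edge_point\<close> maps into the simplex.\<close>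
  have "log_increment (\<lambda>t. u (simplex_map 1 h \<sigma> (edge_point t))) = log_increment (\<lambda>t. u (h (\<sigma> (edge_point t))))" for \<sigma>
    unfolding log_increment_def by (simp add: simplex_map_def edge_point_in_simplex del: One_nat_def)
  then show ?thesis
    by (simp add: winding_def chain_map_def chain_sum_extend o_def)
qed

section \<open>Loops on the unit circle as singular simplices\<close>

definition circle_loop :: "nat \<Rightarrow> (nat \<Rightarrow> real) \<Rightarrow> complex"
  where "circle_loop n = restrict (\<lambda>x. cis (2 * pi * n * x 1)) (standard_simplex 1)"

abbreviation circle :: "complex topology"
  where "circle \<equiv> top_of_set (sphere 0 1)"

lemma singular_simplex_cis:
  assumes "continuous_on UNIV \<theta>"
  shows "singular_simplex n circle (restrict (\<lambda>x. cis (\<theta> x)) (standard_simplex n))"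
proof -
  have "continuous_on UNIV (\<lambda>x. cis (\<theta> x))"
    using assms by (intro continuous_intros)
  then have "continuous_map (powertop_real UNIV) circle (\<lambda>x. cis (\<theta> x))"
    by (auto simp: euclidean_product_topology continuous_map_in_subtopology)
  then have "continuous_map (subtopology (powertop_real UNIV) (standard_simplex n)) circle
      (restrict (\<lambda>x. cis (\<theta> x)) (standard_simplex n))"
    by (rule continuous_map_eq [OF continuous_map_from_subtopology]) simp
  then show ?thesis
    by (simp add: singular_simplex_def)
qed

lemma singular_simplex_circle_loop: "singular_simplex 1 circle (circle_loop n)"
  unfolding circle_loop_def
  by (intro singular_simplex_cis continuous_intros continuous_on_product_coordinates)

lemma circle_loop_edge: "t \<in> {0..1} \<Longrightarrow> circle_loop n (edge_point t) = cis (2 * pi * n * t)"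
  using edge_point_in_simplex [of t] by (simp add: circle_loop_def edge_point_def)

lemma circle_loop_cycle: "singular_relcycle 1 circle {} (frag_of (circle_loop n))"
proof -
  have "cis (2 * pi * real n) = 1"
    using cis_multiple_2pi [of "real n"] by simp
  then have "circle_loop n (edge_point 0) = circle_loop n (edge_point 1)"
    by (simp add: circle_loop_edge)
  then have "singular_face 1 0 (circle_loop n) v = singular_face 1 1 (circle_loop n) v" for v
    using singular_face_1_edge [of v "circle_loop n"]
    by (cases "v \<in> standard_simplex 0") (simp_all add: singular_face_def)
  then have "singular_face 1 0 (circle_loop n) = singular_face 1 1 (circle_loop n)"
    by (rule ext)
  then have "chain_boundary 1 (frag_of (circle_loop n)) = 0"
    by (simp only: chain_boundary_1_of) simp
  then show ?thesis
    using singular_simplex_circle_loop by (simp only: singular_cycle singular_chain_of)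
qed

lemma chain_map_circle_loop:
  "chain_map 1 (\<lambda>z. z ^ n) (frag_of (circle_loop 1)) = frag_of (circle_loop n)"
proof -
  have "cis (2 * pi * real 1 * t) ^ n = cis (2 * pi * n * t)" for t :: real
    unfolding Complex.DeMoivre by (simp add: mult_ac)
  then have "simplex_map 1 (\<lambda>z. z ^ n) (circle_loop 1) = circle_loop n"
    by (simp only: simplex_map_def circle_loop_def restrict_def fun_eq_iff o_def) simp
  then show ?thesis
    by (simp only: chain_map_of)
qed

lemma homologous_circle_loop_Suc:
  "homologous_rel 1 circle {} (frag_of (circle_loop (Suc n))) (frag_of (circle_loop n) + frag_of (circle_loop 1))"
proof -
  \<comment> \<open>The angle is affine on the triangle, with values 0, 2 pi and 2 pi (n + 1) at the
    three vertices. The edges then turn 1, n + 1 and n times; on the last one a constant full turn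
    drops out.\<close>
  define \<tau> where "\<tau> = restrict (\<lambda>x. cis (2 * pi * (x 1 + Suc n * x 2))) (standard_simplex 2)"
  have \<tau>: "singular_simplex 2 circle \<tau>"
    unfolding \<tau>_def by (intro singular_simplex_cis continuous_intros continuous_on_product_coordinates)
  have \<tau>_face: "singular_face 2 k \<tau> = restrict (\<lambda>x. cis (2 * pi * (simplical_face k x 1 + Suc n * simplical_face k x 2)))
      (standard_simplex 1)" if "k \<le> 2" for k
    using that simplical_face_in_standard_simplex [of 2 k]
    by (auto simp: singular_face_def \<tau>_def fun_eq_iff restrict_def)
  have x0: "x 0 = 1 - x 1" if "x \<in> standard_simplex 1" for x
    using that by (auto simp: standard_simplex_def)
  have 0: "singular_face 2 0 \<tau> = circle_loop n"
  proof -
    have "cis (2 * pi * ((1 - t) + Suc n * t)) = cis (2 * pi * n * t)" for t :: real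
    proof -
      have "cis (2 * pi * ((1 - t) + Suc n * t)) = cis (2 * pi) * cis (2 * pi * n * t)"
        unfolding cis_mult by (simp add: algebra_simps)
      then show ?thesis by simp
    qed
    moreover have "simplical_face 0 x 1 = x 0" "simplical_face 0 x 2 = x 1" for x :: "nat \<Rightarrow> real"
      by (simp_all add: simplical_face_def)
    ultimately show ?thesis
      unfolding \<tau>_face [OF zero_le] circle_loop_def
      by (intro restrict_ext) (simp only: x0)
  qed
  have 1: "singular_face 2 1 \<tau> = circle_loop (Suc n)"
    unfolding \<tau>_face [OF one_le_numeral] circle_loop_def
    by (intro restrict_ext) (simp add: simplical_face_def mult_ac)
  have 2: "singular_face 2 2 \<tau> = circle_loop 1"
    unfolding \<tau>_face [OF order_refl] circle_loop_def
    by (intro restrict_ext) (simp add: simplical_face_def)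
  have "chain_boundary 2 (frag_of \<tau>)
      = frag_of (circle_loop n) + frag_of (circle_loop 1) - frag_of (circle_loop (Suc n))"
    unfolding chain_boundary_2_of 0 1 2 by simp
  then have "homologous_rel 1 circle {} (frag_of (circle_loop n) + frag_of (circle_loop 1)) (frag_of (circle_loop (Suc n)))"
    unfolding homologous_rel_def singular_boundary
    using \<tau> by (intro exI [of _ "frag_of \<tau>"]) (simp add: singular_chain_of numeral_2_eq_2)
  then show ?thesis
    by (simp only: homologous_rel_sym)
qed

lemma homologous_circle_loop:
  assumes "n > 0"
  shows "homologous_rel 1 circle {} (frag_of (circle_loop n)) (frag_cmul n (frag_of (circle_loop 1)))"
  using assms
proof (induction n rule: nat_induct_non_zero)
  case 1
  then show ?case by simp
next
  case (Suc n)
  have "homologous_rel 1 circle {} (frag_of (circle_loop n) + frag_of (circle_loop 1))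
     (frag_cmul n (frag_of (circle_loop 1)) + frag_of (circle_loop 1))"
    by (intro homologous_rel_add Suc.IH homologous_rel_refl)
  from homologous_rel_trans [OF this homologous_circle_loop_Suc]
  show ?case
    by (simp add: frag_cmul_distrib algebra_simps)
qed

text \<open>The factor \<open>exp (v z)\<close> has a single-valued logarithm on the circle, so it
  contributes nothing over a full turn.\<close>

lemma winding_circle_loop:
  assumes v: "continuous_on (sphere 0 1) v" and u: "\<And>z. z \<in> sphere 0 1 \<Longrightarrow> u z = z ^ n * exp (v z)"
  shows "winding u (frag_of (circle_loop 1)) = 2 * pi * \<i> * of_nat n"
proof -
  let ?L = "\<lambda>t. of_nat n * (\<i> * of_real (2 * pi * t)) + v (cis (2 * pi * t))"
  have "log_increment (\<lambda>t. u (circle_loop 1 (edge_point t))) = ?L 1 - ?L 0"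
  proof (rule log_increment_eq)
    show "continuous_on {0..1} ?L"
      by (intro continuous_intros continuous_on_compose2 [OF v]) auto
    show "u (circle_loop 1 (edge_point t)) = exp (?L t)" if "t \<in> {0..1}" for t
    proof -
      have "circle_loop 1 (edge_point t) = cis (2 * pi * t)"
        using circle_loop_edge [OF that, of 1] by simp
      moreover have "u (cis (2 * pi * t)) = cis (2 * pi * t) ^ n * exp (v (cis (2 * pi * t)))"
        by (rule u) simp
      ultimately show ?thesis
        by (simp only: exp_add exp_of_nat_mult cis_conv_exp)
    qed
  qed
  then show ?thesis
    by (simp add: winding_def)
qed

section \<open>Torsion in the first homology of the Milnor fiber\<close>

lemma homologous_rel_set_add:
  assumes "singular_relcycle p X S a" "singular_relcycle p X S b"
  shows "homologous_rel_set p X S a \<otimes>\<^bsub>relative_homology_group (int p) X S\<^esub> homologous_rel_set p X S b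
       = homologous_rel_set p X S (a + b)"
proof -
  have "(\<lambda>c. homologous_rel_set p X S c) \<in> hom (relcycle_group p X S) (relative_homology_group (int p) X S)"
    using normal.r_coset_hom_Mod [OF normal_subgroup_singular_relboundary_relcycle [of p X S]]
    by (simp only: right_coset_singular_relboundary nontrivial_relative_homology_group)
  from hom_mult [OF this] assms show ?thesis
    by simp
qed

lemma homologous_rel_set_pow:
  assumes "singular_relcycle p X S a"
  shows "homologous_rel_set p X S a [^]\<^bsub>relative_homology_group (int p) X S\<^esub> n
       = homologous_rel_set p X S (frag_cmul (int n) a)"
proof (induction n)
  case 0
  have "homologous_rel_set p X S 0 = singular_relboundary_set p X S"
    by (simp only: homologous_rel_set_eq_relboundary singular_relboundary_0)
  then show ?case
    by simp
next
  case (Suc n)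
  have "frag_cmul (int n) a + a = frag_cmul (int (Suc n)) a"
    by (simp add: frag_cmul_distrib algebra_simps)
  moreover have "singular_relcycle p X S (frag_cmul (int n) a)"
    using assms by (rule singular_relcycle_cmul)
  ultimately show ?case
    using homologous_rel_set_add [OF _ assms] Suc by simp
qed

text \<open>The order of the class divides \<open>p\<close> and is not 1; primality leaves only
  \<open>p\<close>.\<close>

lemma has_p_torsionI:
  assumes p: "Factorial_Ring.prime p" and a: "singular_relcycle q X {} a"
    and "\<not> singular_relboundary q X {} a" "singular_relboundary q X {} (frag_cmul (int p) a)"
  shows "has_p_torsion p (homology_group (int q) X)"
proof -
  let ?H = "homology_group (int q) X" and ?x = "homologous_rel_set q X {} a"
  interpret H: group ?H
    by simp
  have x: "?x \<in> carrier ?H"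
    using a by (auto simp: carrier_relative_homology_group)
  have "?x [^]\<^bsub>?H\<^esub> p = \<one>\<^bsub>?H\<^esub>"
    unfolding homologous_rel_set_pow [OF a] one_relative_homology_group homologous_rel_set_eq_relboundary
    by fact
  then have "H.ord ?x dvd p"
    using H.pow_eq_id x by blast
  moreover have "?x \<noteq> \<one>\<^bsub>?H\<^esub>"
    unfolding one_relative_homology_group homologous_rel_set_eq_relboundary by fact
  then have "H.ord ?x \<noteq> 1"
    using H.ord_eq_1 x by blast
  ultimately have "H.ord ?x = p"
    using p prime_nat_iff by blast
  then show ?thesis
    using x by (auto simp: has_p_torsion_def)
qed

lemma homologous_rel_homotopic:
  assumes "homotopic_with (\<lambda>_. True) X Y f g" and c: "singular_relcycle n X {} c"
  shows "homologous_rel n Y {} (chain_map n f c) (chain_map n g c)"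
proof -
  have fg: "continuous_map X Y f" "continuous_map X Y g"
    using homotopic_with_imp_continuous_maps [OF assms(1)] by auto
  have "hom_induced (int n) X {} Y {} f (homologous_rel_set n X {} c) = hom_induced (int n) X {} Y {} g (homologous_rel_set n X {} c)"
    using homology_homotopy_empty [OF assms(1)] by metis
  then have "homologous_rel_set n Y {} (chain_map n f c) = homologous_rel_set n Y {} (chain_map n g c)"
    using fg c by (simp only: hom_induced_chain_map Pi_empty UNIV_I)
  then show ?thesis
    by (simp only: homologous_rel_set_eq)
qed

lemma homologous_rel_chain_map:
  assumes "continuous_map X Y f" "homologous_rel n X {} a b"
  shows "homologous_rel n Y {} (chain_map n f a) (chain_map n f b)"
  using singular_relboundary_chain_map [of n X "{}" "a - b" Y f "{}"] assms
  by (simp add: homologous_rel_def chain_map_diff)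

text \<open>The exactness of the Mayer--Vietoris sequence at \<open>H\<^sub>n(A) \<oplus> H\<^sub>n(B)\<close>, on classes coming from \<open>A\<close>.\<close>

lemma cycle_bounding_in_union:
  assumes A: "openin X A" and B: "openin X B" and AB: "A \<union> B = topspace X"
    and a: "singular_relcycle n (subtopology X A) {} a" and bd: "singular_relboundary n X {} a"
  obtains c where "singular_relcycle n (subtopology X (A \<inter> B)) {} c"
    "homologous_rel n (subtopology X A) {} a c" "singular_relboundary n (subtopology X B) {} c"
proof -
  let ?N = "int (Suc n)" and ?U = "topspace X - B"
  have n1: "?N - 1 = int n" by simp
  have subA: "A \<subseteq> topspace X" and subB: "B \<subseteq> topspace X"
    using A B by (auto dest: openin_subset)
  have sets: "topspace X - ?U = B" "A - ?U = A \<inter> B"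
    using subA subB by auto
  let ?a = "homologous_rel_set n (subtopology X A) {} a"
  have "?a \<in> carrier (homology_group (?N - 1) (subtopology X A))"
    unfolding n1 using a by (auto simp: carrier_relative_homology_group)
  moreover have "hom_induced (?N - 1) (subtopology X A) {} X {} id ?a = \<one>\<^bsub>homology_group (?N - 1) X\<^esub>"
  proof -
    have "hom_induced (int n) (subtopology X A) {} X {} id ?a = homologous_rel_set n X {} (chain_map n id a)"
      using a by (intro hom_induced_chain_map) auto
    also have "chain_map n id a = a"
      using a by (intro chain_map_ident [of n "subtopology X A"]) (auto simp: singular_cycle)
    finally show ?thesis
      using bd by (simp only: n1 one_relative_homology_group homologous_rel_set_eq_relboundary)
  qed
  ultimately have "?a \<in> kernel (homology_group (?N - 1) (subtopology X A)) (homology_group (?N - 1) X)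
      (hom_induced (?N - 1) (subtopology X A) {} X {} id)"
    by (simp only: kernel_def mem_Collect_eq)
  \<comment> \<open>The class of \<open>a\<close> dies in \<open>X\<close>, so exactness makes it
    the boundary of a relative class \<open>e\<close> of the pair \<open>(X, A)\<close>.\<close>
  then obtain e where e: "e \<in> carrier (relative_homology_group ?N X A)" "?a = hom_boundary ?N X A e"
    using homology_exactness_axiom_2 [of ?N X A] unfolding exact_seq_cons_iff by blast
  have "closedin X ?U"
    using B by (simp add: closedin_diff)
  then have "Abstract_Topology.closure_of X ?U \<subseteq> Abstract_Topology.interior_of X A"
    using A AB by (auto simp: closure_of_closedin interior_of_openin)
  \<comment> \<open>Excising the complement of \<open>B\<close> replaces \<open>(X, A)\<close> by
    \<open>(B, A \<inter> B)\<close>. Hence \<open>e\<close> is represented by a chain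
    \<open>d\<close> in \<open>B\<close> with boundary in \<open>A \<inter> B\<close>, and this
    boundary is the required cycle.\<close>
  from homology_excision_axiom [OF this subA, of ?N]
  have "hom_induced ?N (subtopology X B) (A \<inter> B) X A id ` carrier (relative_homology_group ?N (subtopology X B) (A \<inter> B))
      = carrier (relative_homology_group ?N X A)"
    unfolding sets iso_iff by simp
  then obtain e' where e': "e' \<in> carrier (relative_homology_group ?N (subtopology X B) (A \<inter> B))"
    "e = hom_induced ?N (subtopology X B) (A \<inter> B) X A id e'"
    using e(1) by blast
  then obtain d where d: "singular_relcycle (Suc n) (subtopology X B) (A \<inter> B) d"
    "e' = homologous_rel_set (Suc n) (subtopology X B) (A \<inter> B) d"
    unfolding carrier_relative_homology_group by blast
  have ch: "singular_chain (Suc n) (subtopology X B) d"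
    using d(1) by (simp add: singular_relcycle)
  have AB': "subtopology (subtopology X B) (A \<inter> B) = subtopology X (A \<inter> B)"
    by (simp add: subtopology_subtopology Int_ac)
  have ch': "singular_chain n (subtopology X (A \<inter> B)) (chain_boundary (Suc n) d)"
    using d(1) unfolding singular_relcycle AB' by simp
  have c: "singular_relcycle n (subtopology X (A \<inter> B)) {} (chain_boundary (Suc n) d)"
    using ch' chain_boundary_boundary [OF ch] by (simp add: singular_cycle)
  have "e = homologous_rel_set (Suc n) X A (chain_map (Suc n) id d)"
    unfolding e'(2) d(2) using d(1) by (intro hom_induced_chain_map) auto
  then have "e = homologous_rel_set (Suc n) X A d"
    using chain_map_ident [OF ch] by simp
  moreover have "singular_relcycle (Suc n) X A d"
    unfolding singular_relcycle
    using ch ch' singular_chain_mono [of n X "A \<inter> B" _ A] by (auto simp: singular_chain_subtopology)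
  ultimately have "?a = homologous_rel_set n (subtopology X A) {} (chain_boundary (Suc n) d)"
    using e(2) hom_boundary_chain_boundary [of "Suc n" X A d] by simp
  then have "homologous_rel n (subtopology X A) {} a (chain_boundary (Suc n) d)"
    by (simp only: homologous_rel_set_eq)
  moreover have "singular_relboundary n (subtopology X B) {} (chain_boundary (Suc n) d)"
    using ch by (auto simp: singular_boundary)
  ultimately show thesis
    using c that by blast
qed

text \<open>The pair \<open>(u, v)\<close> is a Cech cocycle with values in \<open>\<int>/p\<close>: the winding number modulo \<open>p\<close> of
  \<open>u\<close> on \<open>A\<close> and \<open>v\<close> on \<open>B\<close> is well defined on \<open>H\<^sub>1(A \<union> B)\<close>.\<close>

lemma winding_bounding_cycle:
  assumes A: "openin X A" and B: "openin X B" and AB: "A \<union> B = topspace X"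
    and u: "nonvanishing_on (subtopology X A) u" and v: "nonvanishing_on (subtopology X B) v"
    and w: "nonvanishing_on (subtopology X (A \<inter> B)) w"
    and uvw: "\<And>x. x \<in> A \<inter> B \<Longrightarrow> u x = v x * w x ^ p"
    and a: "singular_relcycle 1 (subtopology X A) {} a" "singular_relboundary 1 X {} a"
  shows "\<exists>n::int. winding u a = 2 * pi * \<i> * (int p * n)"
proof -
  obtain c where c: "singular_relcycle 1 (subtopology X (A \<inter> B)) {} c"
    "homologous_rel 1 (subtopology X A) {} a c" "singular_relboundary 1 (subtopology X B) {} c"
    using cycle_bounding_in_union [OF A B AB a] by blast
  have v': "nonvanishing_on (subtopology X (A \<inter> B)) v"
    using v by (auto simp: nonvanishing_on_def intro: continuous_map_from_subtopology_mono)
  obtain n :: int where n: "winding w c = 2 * pi * \<i> * n"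
    using winding_cycle [OF w c(1)] by blast
  have "winding u a = winding u c"
    using u c(2) by (rule winding_homologous)
  also have "\<dots> = winding v c + of_nat p * winding w c"
    using c(1) uvw by (intro winding_mult_power [OF v' w]) (auto simp: singular_cycle)
  also have "winding v c = 0"
    using v c(3) by (rule winding_boundary)
  finally show ?thesis
    using n by (intro exI [of _ n]) simp
qed

section \<open>The Milnor fiber in the coordinates X, Y, W, and its torsion class\<close>

context
  fixes i j k :: "'n::finite" and p :: nat
  assumes ijk: "i \<noteq> j" "i \<noteq> k" "j \<noteq> k" and p: "p > 0"
begin

abbreviation fiber :: "(complex ^ 'n) set"
  where "fiber \<equiv> milnor_fiber (torsion_poly p i j k)"

definition fiber_x :: "complex ^ 'n \<Rightarrow> complex"
  where "fiber_x v = v $ i * (v $ k) ^ p"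

definition fiber_w :: "complex ^ 'n \<Rightarrow> complex"
  where "fiber_w v = fiber_x v * v $ k"

text \<open>Solves for the original coordinates: \<open>W = X z\<close> gives
  \<open>z = W / X\<close>, and then \<open>X = x z^p\<close> gives
  \<open>x = X^(p+1) / W^p\<close>. Coordinates other than the three chosen ones are set to
  0.\<close>

definition fiber_point :: "complex \<Rightarrow> complex \<Rightarrow> complex \<Rightarrow> complex ^ 'n"
  where "fiber_point x y w =
    (\<chi> m. if m = i then x ^ (p + 1) / w ^ p else if m = j then y else if m = k then w / x else 0)"

text \<open>With \<open>X = x z^p\<close> the two monomials of the polynomial are \<open>X^2\<close>
  and \<open>X z y^p\<close>.\<close>

lemma milnor_fiber_iff: "v \<in> fiber \<longleftrightarrow> fiber_x v * (fiber_x v - v $ k * (v $ j) ^ p) = 1"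
proof -
  obtain q where "p = Suc q"
    using p gr0_implies_Suc by blast
  then show ?thesis
    unfolding milnor_fiber_def torsion_poly_def fiber_x_def by (simp add: algebra_simps)
qed

lemma fiber_nonzero:
  assumes "v \<in> fiber"
  shows "fiber_x v \<noteq> 0" "v $ k \<noteq> 0" "fiber_w v \<noteq> 0"
proof -
  show x: "fiber_x v \<noteq> 0"
    using assms by (auto simp: milnor_fiber_iff)
  then show "v $ k \<noteq> 0"
    using p by (auto simp: fiber_x_def)
  with x show "fiber_w v \<noteq> 0"
    by (simp add: fiber_w_def)
qed

lemma fiber_equation: "v \<in> fiber \<Longrightarrow> fiber_x v ^ 2 - 1 = fiber_w v * (v $ j) ^ p"
  by (auto simp: milnor_fiber_iff fiber_w_def algebra_simps power2_eq_square)

lemma fiber_point: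
  assumes "x \<noteq> 0" "w \<noteq> 0" "x ^ 2 - 1 = w * y ^ p"
  shows "fiber_point x y w \<in> fiber" "fiber_x (fiber_point x y w) = x"
    "fiber_w (fiber_point x y w) = w" "fiber_point x y w $ j = y"
proof -
  have k: "fiber_point x y w $ k = w / x" and j: "fiber_point x y w $ j = y"
    using ijk by (auto simp: fiber_point_def)
  show x: "fiber_x (fiber_point x y w) = x"
    using assms ijk by (simp add: fiber_x_def fiber_point_def power_divide)
  show "fiber_w (fiber_point x y w) = w"
    using assms by (simp add: fiber_w_def x k)
  show "fiber_point x y w $ j = y" by (rule j)
  show "fiber_point x y w \<in> fiber"
    using assms by (simp add: milnor_fiber_iff x k j field_simps power2_eq_square)
qed

lemma continuous_on_fiber_point:
  assumes "continuous_on S x" "continuous_on S y" "continuous_on S w"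
    and "\<And>s. s \<in> S \<Longrightarrow> x s \<noteq> 0" "\<And>s. s \<in> S \<Longrightarrow> w s \<noteq> 0"
  shows "continuous_on S (\<lambda>s. fiber_point (x s) (y s) (w s))"
proof -
  have "continuous_on S (\<lambda>s. if m = i then x s ^ (p + 1) / w s ^ p else if m = j then y s
      else if m = k then w s / x s else 0)" for m
    using assms by (cases "m = i"; cases "m = j"; cases "m = k") (simp_all add: continuous_intros)
  then show ?thesis
    unfolding fiber_point_def by (rule continuous_on_vec_lambda)
qed

text \<open>Reduces a homotopy of loops in the fiber to three complex functions satisfying
  \<open>X^2 - 1 = W Y^p\<close> with \<open>X\<close> and \<open>W\<close> nonzero.\<close>

lemma homotopic_fiber_point:
  fixes x y w :: "real \<times> complex \<Rightarrow> complex"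
  assumes "continuous_on ({0..1} \<times> sphere 0 1) x" "continuous_on ({0..1} \<times> sphere 0 1) y"
    "continuous_on ({0..1} \<times> sphere 0 1) w"
    and "\<And>s. s \<in> {0..1} \<times> sphere 0 1 \<Longrightarrow> x s \<noteq> 0 \<and> w s \<noteq> 0 \<and> x s ^ 2 - 1 = w s * y s ^ p"
    and f: "\<And>z. z \<in> sphere 0 1 \<Longrightarrow> f z = fiber_point (x (0, z)) (y (0, z)) (w (0, z))"
    and g: "\<And>z. z \<in> sphere 0 1 \<Longrightarrow> g z = fiber_point (x (1, z)) (y (1, z)) (w (1, z))"
  shows "homotopic_with (\<lambda>_. True) circle (top_of_set fiber) f g"
proof (rule homotopic_with_eq)
  let ?h = "\<lambda>s. fiber_point (x s) (y s) (w s)"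
  have "continuous_on ({0..1} \<times> sphere 0 1) ?h"
    using assms by (intro continuous_on_fiber_point) auto
  moreover have "?h ` ({0..1} \<times> sphere 0 1) \<subseteq> fiber"
    using assms fiber_point(1) by blast
  ultimately show "homotopic_with (\<lambda>_. True) circle (top_of_set fiber) (\<lambda>z. ?h (0, z)) (\<lambda>z. ?h (1, z))"
    unfolding homotopic_with_def by (intro exI [of _ ?h]) (auto simp: image_subset_iff)
  show "f z = ?h (0, z)" "g z = ?h (1, z)" if "z \<in> topspace circle" for z
    using that f g by auto
qed auto

text \<open>For \<open>s = \<plusminus>1\<close> the loops \<open>singular_fiber s\<close> run once around the two fibers of multiplicity \<open>p\<close> of
  \<^term>\<open>fiber_x\<close>; \<open>nearby_fiber s\<close> is a parallel copy avoiding \<open>x = \<plusminus>1\<close>.\<close>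

definition singular_fiber :: "complex \<Rightarrow> complex \<Rightarrow> complex ^ 'n"
  where "singular_fiber s z = fiber_point s 0 (z / 2)"

definition nearby_fiber :: "complex \<Rightarrow> complex \<Rightarrow> complex ^ 'n"
  where "nearby_fiber s z = fiber_point (s * csqrt (1 + z / 2)) 1 (z / 2)"

text \<open>This is why the loops use \<open>w = z / 2\<close>: the argument of \<open>csqrt\<close>
  stays in the right half-plane, away from the branch cut.\<close>

lemma Re_half_pos:
  assumes "cmod z = 1" "0 \<le> t" "t \<le> (1::real)"
  shows "Re (1 + of_real t * z / 2) > 0"
proof -
  have "\<bar>Re (of_real t * z)\<bar> \<le> 1"
    using abs_Re_le_cmod [of "of_real t * z"] assms by (simp add: norm_mult)
  then show ?thesis
    by simp
qed

lemma continuous_on_csqrt_compose: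
  assumes "continuous_on S f" "\<And>s. s \<in> S \<Longrightarrow> Re (f s) > 0"
  shows "continuous_on S (\<lambda>s. csqrt (f s))"
proof -
  have "continuous_on {z. Re z > 0} csqrt"
    by (intro continuous_at_imp_continuous_on) (auto intro!: continuous_at_csqrt simp: complex_nonpos_Reals_iff)
  then show ?thesis
    by (rule continuous_on_compose2) (use assms in auto)
qed

lemma csqrt_half:
  assumes "z \<in> sphere 0 1"
  shows "csqrt (1 + z / 2) ^ 2 = 1 + z / 2" "Re (csqrt (1 + z / 2)) \<ge> 0" "csqrt (1 + z / 2) \<noteq> 0"
    "csqrt (1 + z / 2) \<noteq> 1" "csqrt (1 + z / 2) \<noteq> -1"
proof -
  show sq: "csqrt (1 + z / 2) ^ 2 = 1 + z / 2"
    by simp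
  show "Re (csqrt (1 + z / 2)) \<ge> 0"
    by (rule Re_csqrt)
  have "Re (1 + z / 2) > 0"
    using Re_half_pos [of z 1] assms by simp
  then have "1 + z / 2 \<noteq> 0"
    by (metis less_irrefl zero_complex.sel(1))
  then show "csqrt (1 + z / 2) \<noteq> 0"
    by simp
  have "z \<noteq> 0"
    using assms by auto
  then show "csqrt (1 + z / 2) \<noteq> 1" "csqrt (1 + z / 2) \<noteq> -1"
    using sq by (auto simp: power2_eq_square)
qed

lemma homotopic_singular_nearby:
  assumes s: "s ^ 2 = 1"
  shows "homotopic_with (\<lambda>_. True) circle (top_of_set fiber) (singular_fiber s) (nearby_fiber s)"
proof -
  \<comment> \<open>The homotopy moves \<open>y = t\<close> from 0 to 1 with
    \<open>w = z / 2\<close> fixed. The equation then forces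
    \<open>x^2 = 1 + t^p z / 2\<close>.\<close>
  let ?c = "\<lambda>(t, z). csqrt (1 + of_real (t ^ p) * z / 2)"
  have s0: "s \<noteq> 0"
    using s by auto
  have re: "Re (1 + of_real (t ^ p) * z / 2) > 0" if "t \<in> {0..1}" "z \<in> sphere 0 1" for t z
    using that Re_half_pos [of z "t ^ p"] by (auto simp: power_le_one)
  have c: "continuous_on ({0..1} \<times> sphere 0 1) ?c"
    unfolding case_prod_unfold
    by (rule continuous_on_csqrt_compose) (use re in \<open>auto intro!: continuous_intros\<close>)
  show ?thesis
  proof (rule homotopic_fiber_point [of "\<lambda>u. s * ?c u" "\<lambda>u. of_real (fst u)" "\<lambda>u. snd u / 2"])
    show "continuous_on ({0..1} \<times> sphere 0 1) (\<lambda>u. s * ?c u)"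
      by (intro continuous_intros c)
    show "s * ?c u \<noteq> 0 \<and> snd u / 2 \<noteq> 0 \<and> (s * ?c u) ^ 2 - 1 = snd u / 2 * of_real (fst u) ^ p"
      if "u \<in> {0..1} \<times> sphere 0 1" for u
    proof -
      obtain t z where u: "u = (t, z)" "t \<in> {0..1}" "z \<in> sphere 0 1"
        using \<open>u \<in> _\<close> by auto
      have "1 + of_real (t ^ p) * z / 2 \<noteq> 0"
        using re [OF u(2,3)] by (metis less_irrefl zero_complex.sel(1))
      moreover have "z \<noteq> 0"
        using u by auto
      ultimately show ?thesis
        using s s0 by (simp add: u power_mult_distrib)
    qed
  qed (use p in \<open>auto simp: singular_fiber_def nearby_fiber_def zero_power intro!: continuous_intros\<close>)
qed

text \<open>The path \<open>x = exp (\<i> \<pi> t)\<close> from \<open>1\<close> to \<open>-1\<close> carries a continuous \<open>p\<close>-th root of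
  \<open>2 (x\<^sup>2 - 1)\<close> vanishing at both ends, so the \<open>p\<close>-fold singular fibers are homotopic through regular ones.\<close>

lemma homotopic_singular_fibers_power:
  "homotopic_with (\<lambda>_. True) circle (top_of_set fiber) (singular_fiber 1 \<circ> (\<lambda>z. z ^ p)) (singular_fiber (-1) \<circ> (\<lambda>z. z ^ p))"
proof -
  \<comment> \<open>For \<open>x = cis (pi * t)\<close> one has
    \<open>2 (x^2 - 1) = 4 sin (pi t) cis (pi t + pi / 2)\<close>, with nonnegative modulus. Taking
    the root of the modulus and dividing the angle by \<open>p\<close> gives a continuous
    \<open>p\<close>-th root.\<close>
  let ?r = "\<lambda>t. of_real (root p (4 * sin (pi * t))) * cis ((pi * t + pi / 2) / p)"
  have r: "?r t ^ p = 2 * (cis (pi * t) ^ 2 - 1)" if "t \<in> {0..1}" for t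
  proof -
    have "pi * t \<le> pi * 1"
      using that by (intro mult_left_mono) auto
    then have "0 \<le> sin (pi * t)"
      using that by (intro sin_ge_zero) auto
    then have "root p (4 * sin (pi * t)) ^ p = 4 * sin (pi * t)"
      using p by simp
    moreover have "cis ((pi * t + pi / 2) / p) ^ p = cis (pi * t) * \<i>"
      using p by (simp add: Complex.DeMoivre flip: cis_mult)
    ultimately have "?r t ^ p = of_real (4 * sin (pi * t)) * (cis (pi * t) * \<i>)"
      by (simp add: power_mult_distrib flip: of_real_power)
    also have "\<dots> = 2 * (cis (pi * t) ^ 2 - 1)"
    proof -
      have "cis (pi * t) - cis (- (pi * t)) = 2 * \<i> * sin (pi * t)"
        by (simp add: complex_eq_iff)
      then have "of_real (4 * sin (pi * t)) * (cis (pi * t) * \<i>) = 2 * (cis (pi * t) * (cis (pi * t) - cis (- (pi * t))))"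
        by simp
      also have "cis (pi * t) * (cis (pi * t) - cis (- (pi * t))) = cis (pi * t) ^ 2 - 1"
        by (simp only: right_diff_distrib cis_mult power2_eq_square) simp
      finally show ?thesis .
    qed
    finally show ?thesis .
  qed
  show ?thesis
  \<comment> \<open>Running \<open>p\<close> times around, \<open>w = z^p / 2\<close>, makes
    \<open>y = ?r / z\<close> single-valued: the powers of \<open>z\<close> cancel in
    \<open>w y^p = ?r^p / 2\<close>.\<close>
  proof (rule homotopic_fiber_point [of "\<lambda>u. cis (pi * fst u)" "\<lambda>u. ?r (fst u) / snd u" "\<lambda>u. snd u ^ p / 2"])
    show "cis (pi * fst u) \<noteq> 0 \<and> snd u ^ p / 2 \<noteq> 0 \<and> cis (pi * fst u) ^ 2 - 1 = snd u ^ p / 2 * (?r (fst u) / snd u) ^ p"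
      if "u \<in> {0..1} \<times> sphere 0 1" for u
    proof -
      have "snd u \<noteq> 0" "fst u \<in> {0..1}"
        using that by auto
      then show ?thesis
        using r [of "fst u"] by (simp add: power_divide)
    qed
    show "continuous_on ({0..1} \<times> sphere 0 1) (\<lambda>u::real \<times> complex. ?r (fst u) / snd u)"
      using p by (auto intro!: continuous_intros)
  qed (use p in \<open>auto simp: singular_fiber_def zero_power intro!: continuous_intros\<close>)
qed

text \<open>Nearby loops replace the singular ones because the singular fiber over -1 lies outside
  the open set where \<open>fiber_x\<close> differs from -1, on which the first function of the
  cocycle is defined.\<close>

abbreviation torsion_cycle :: "(complex ^ 'n) chain"
  where "torsion_cycle \<equiv> chain_map 1 (nearby_fiber 1) (frag_of (circle_loop 1))
     - chain_map 1 (nearby_fiber (-1)) (frag_of (circle_loop 1))"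

lemma nearby_fiber:
  assumes "s ^ 2 = 1" "z \<in> sphere 0 1"
  shows "nearby_fiber s z \<in> fiber" "fiber_x (nearby_fiber s z) = s * csqrt (1 + z / 2)" "fiber_w (nearby_fiber s z) = z / 2"
    "fiber_x (nearby_fiber s z) \<noteq> -1"
proof -
  have "s \<noteq> 0" "z \<noteq> 0"
    using assms by auto
  moreover have "(s * csqrt (1 + z / 2)) ^ 2 - 1 = z / 2 * 1 ^ p"
    using assms csqrt_half(1) [OF assms(2)] by (simp add: power_mult_distrib)
  ultimately show "nearby_fiber s z \<in> fiber" "fiber_w (nearby_fiber s z) = z / 2"
    and x: "fiber_x (nearby_fiber s z) = s * csqrt (1 + z / 2)"
    unfolding nearby_fiber_def using csqrt_half(3) [OF assms(2)] by (simp_all add: fiber_point)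
  have "s = 1 \<or> s = -1"
    using assms(1) by (simp add: power2_eq_1_iff)
  then show "fiber_x (nearby_fiber s z) \<noteq> -1"
    using csqrt_half(4,5) [OF assms(2)] by (auto simp: x)
qed

lemma continuous_on_fiber_coords:
  "continuous_on S fiber_x" "continuous_on S fiber_w" "continuous_on S (\<lambda>v :: complex ^ 'n. v $ j)"
  unfolding fiber_w_def fiber_x_def by (intro continuous_intros)+

lemma torsion_cycle:
  "singular_relcycle 1 (top_of_set (fiber \<inter> {v. fiber_x v \<noteq> -1})) {} torsion_cycle"
proof -
  have "continuous_map circle (top_of_set (fiber \<inter> {v. fiber_x v \<noteq> -1})) (nearby_fiber s)" if s: "s ^ 2 = 1" for s
  proof -
    have "continuous_on (sphere 0 1) (nearby_fiber s)"
      unfolding nearby_fiber_def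
    proof (rule continuous_on_fiber_point)
      show "continuous_on (sphere 0 1) (\<lambda>z. s * csqrt (1 + z / 2))"
        using Re_half_pos [of _ 1] by (intro continuous_on_mult_left continuous_on_csqrt_compose continuous_intros) auto
    qed (use s csqrt_half(3) in \<open>auto intro!: continuous_intros\<close>)
    then show ?thesis
      using nearby_fiber [OF s] by (auto simp: continuous_map_in_subtopology)
  qed
  then show ?thesis
    by (intro singular_relcycle_diff singular_relcycle_chain_map [OF circle_loop_cycle]) auto
qed

text \<open>For each sign, \<open>p\<close> times the nearby loop is homologous to the
  \<open>p\<close>-fold singular fiber, and the two \<open>p\<close>-fold singular fibers are
  homotopic to each other.\<close>

lemma torsion_cycle_boundary:
  "singular_relboundary 1 (top_of_set fiber) {} (frag_cmul (int p) torsion_cycle)"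
proof -
  let ?R = "homologous_rel 1 (top_of_set fiber) {}" and ?\<gamma> = "frag_of (circle_loop 1)" and ?P = "\<lambda>z :: complex. z ^ p"
  have P: "continuous_map circle circle ?P"
    by (auto simp: norm_power intro!: continuous_intros)
  \<comment> \<open>Multiplying the loop by \<open>p\<close> amounts, up to homology, to
    precomposing with \<open>z ^ p\<close>; the nearby loop is then deformed to the singular
    fiber.\<close>
  have step: "?R (frag_cmul (int p) (chain_map 1 (nearby_fiber s) ?\<gamma>)) (chain_map 1 (singular_fiber s \<circ> ?P) ?\<gamma>)"
    if s: "s ^ 2 = 1" for s
  proof -
    note h = homotopic_singular_nearby [OF s]
    have "?R (chain_map 1 (nearby_fiber s) (frag_of (circle_loop p))) (chain_map 1 (nearby_fiber s) (frag_cmul (int p) ?\<gamma>))"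
      using homotopic_with_imp_continuous_maps [OF h] homologous_circle_loop [OF p] by (intro homologous_rel_chain_map) auto
    moreover have "chain_map 1 (nearby_fiber s) (frag_of (circle_loop p)) = chain_map 1 (nearby_fiber s \<circ> ?P) ?\<gamma>"
      by (simp only: chain_map_compose o_apply chain_map_circle_loop)
    moreover have "homotopic_with (\<lambda>_. True) circle (top_of_set fiber) (singular_fiber s \<circ> ?P) (nearby_fiber s \<circ> ?P)"
      using P h by (intro homotopic_with_compose_continuous_map_right [OF h]) auto
    then have "?R (chain_map 1 (singular_fiber s \<circ> ?P) ?\<gamma>) (chain_map 1 (nearby_fiber s \<circ> ?P) ?\<gamma>)"
      by (rule homologous_rel_homotopic [OF _ circle_loop_cycle])
    ultimately have "?R (chain_map 1 (singular_fiber s \<circ> ?P) ?\<gamma>) (chain_map 1 (nearby_fiber s) (frag_cmul (int p) ?\<gamma>))"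
      by (simp only: homologous_rel_trans)
    then show ?thesis
      by (simp only: homologous_rel_sym chain_map_cmul)
  qed
  have "?R (frag_cmul (int p) torsion_cycle)
      (chain_map 1 (singular_fiber 1 \<circ> ?P) ?\<gamma> - chain_map 1 (singular_fiber (-1) \<circ> ?P) ?\<gamma>)"
  proof -
    have "frag_cmul (int p) (a - b) = frag_cmul (int p) a - frag_cmul (int p) b" for a b :: "(complex ^ 'n) chain"
      by (rule poly_mapping_eqI) (simp add: lookup_minus algebra_simps)
    then show ?thesis
      by (simp only:) (intro homologous_rel_diff step; simp)
  qed
  moreover have "?R (chain_map 1 (singular_fiber 1 \<circ> ?P) ?\<gamma>) (chain_map 1 (singular_fiber (-1) \<circ> ?P) ?\<gamma>)"
    by (rule homologous_rel_homotopic [OF homotopic_singular_fibers_power circle_loop_cycle])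
  ultimately show ?thesis
    unfolding homologous_rel_def using singular_relboundary_add by force
qed

text \<open>If the cycle bounded, the winding number of \<open>W / (X + 1)\<close> would be
  divisible by \<open>p\<close>. It is 1, since the function winds once along the nearby loop at 1
  and not at all along the one at -1.\<close>

lemma not_torsion_cycle_boundary:
  assumes "p > 1"
  shows "\<not> singular_relboundary 1 (top_of_set fiber) {} torsion_cycle"
proof
  assume bd: "singular_relboundary 1 (top_of_set fiber) {} torsion_cycle"
  let ?X = "top_of_set fiber" and ?A = "fiber \<inter> {v. fiber_x v \<noteq> -1}" and ?B = "fiber \<inter> {v. fiber_x v \<noteq> 1}"
  let ?u = "\<lambda>v. fiber_w v / (fiber_x v + 1)" and ?\<gamma> = "frag_of (circle_loop 1)"
  have sub: "subtopology ?X (fiber \<inter> T) = top_of_set (fiber \<inter> T)" "subtopology ?X (fiber \<inter> S \<inter> (fiber \<inter> T)) = top_of_set (fiber \<inter> S \<inter> (fiber \<inter> T))" for S T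
    by (simp_all add: subtopology_subtopology Int_ac)
  have op: "openin ?X (fiber \<inter> {v. fiber_x v \<noteq> c})" for c
    by (intro openin_open_Int open_Collect_neq continuous_on_fiber_coords continuous_intros)
  have "\<exists>n::int. winding ?u torsion_cycle = 2 * pi * \<i> * (int p * n)"
  proof (rule winding_bounding_cycle [OF op op])
    show "?A \<union> ?B = topspace ?X"
      by auto
    show "nonvanishing_on (subtopology ?X ?A) ?u"
      unfolding sub using fiber_nonzero
      by (auto simp: nonvanishing_on_def add_eq_0_iff2 intro!: continuous_intros continuous_on_fiber_coords)
    show "nonvanishing_on (subtopology ?X ?B) (\<lambda>v. fiber_x v - 1)"
      unfolding sub by (auto simp: nonvanishing_on_def intro!: continuous_intros continuous_on_fiber_coords)
    \<comment> \<open>On the overlap \<open>X^2 - 1\<close> is nonzero, so the equation of the fiber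
      forces \<open>Y\<close> to be nonzero.\<close>
    have y: "v $ j \<noteq> 0" if "v \<in> ?A \<inter> ?B" for v
      using that fiber_equation [of v] p power2_eq_1_iff [of "fiber_x v"] by (auto simp: zero_power)
    then show "nonvanishing_on (subtopology ?X (?A \<inter> ?B)) (\<lambda>v. 1 / v $ j)"
      unfolding sub by (auto simp: nonvanishing_on_def intro!: continuous_intros continuous_on_fiber_coords)
    show "?u v = (fiber_x v - 1) * (1 / v $ j) ^ p" if v: "v \<in> ?A \<inter> ?B" for v
    proof -
      have "fiber_x v + 1 \<noteq> 0"
        using v by (auto simp: add_eq_0_iff2)
      moreover have "(fiber_x v - 1) * (fiber_x v + 1) = fiber_w v * (v $ j) ^ p"
        using fiber_equation [of v] v by (simp add: algebra_simps power2_eq_square)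
      ultimately show ?thesis
        using y [OF v] by (simp add: field_simps)
    qed
    show "singular_relcycle 1 (subtopology ?X ?A) {} torsion_cycle"
      unfolding sub by (rule torsion_cycle)
  qed (rule bd)
  then obtain n :: int where n: "winding ?u torsion_cycle = 2 * pi * \<i> * (int p * n)"
    by blast
  let ?q = "\<lambda>z. csqrt (1 + z / 2)"
  have q: "continuous_on (sphere 0 1) ?q"
    using Re_half_pos [of _ 1] by (intro continuous_on_csqrt_compose continuous_intros) auto
  \<comment> \<open>The values \<open>1 + ?q z\<close> stay in the right half-plane, so
    \<open>Ln\<close> is a single-valued logarithm of them and they do not wind.\<close>
  have Re: "Re (1 + ?q z) > 0" if "z \<in> sphere 0 1" for z
    using csqrt_half(2) [OF that] unfolding plus_complex.sel one_complex.sel by linarith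
  have Ln: "continuous_on (sphere 0 1) (\<lambda>z. Ln (1 + ?q z))"
  proof (intro continuous_intros q)
    show "1 + ?q z \<notin> \<real>\<^sub>\<le>\<^sub>0" if "z \<in> sphere 0 1" for z
      using Re [OF that] by (meson complex_nonpos_Reals_iff not_le)
  qed
  have nz: "1 + ?q z \<noteq> 0" if "z \<in> sphere 0 1" for z
    using Re [OF that] by (metis less_irrefl zero_complex.sel(1))
  \<comment> \<open>Here the function is \<open>(z / 2) / (1 + ?q z)\<close>: only the factor
    \<open>z\<close> winds.\<close>
  have "winding (?u \<circ> nearby_fiber 1) ?\<gamma> = 2 * pi * \<i> * of_nat 1"
  proof (rule winding_circle_loop)
    show "continuous_on (sphere 0 1) (\<lambda>z. - Ln 2 - Ln (1 + ?q z))"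
      by (intro continuous_intros Ln)
    show "(?u \<circ> nearby_fiber 1) z = z ^ 1 * exp (- Ln 2 - Ln (1 + ?q z))" if "z \<in> sphere 0 1" for z
    proof -
      have "exp (- Ln 2 - Ln (1 + ?q z)) = 1 / 2 / (1 + ?q z)"
        unfolding exp_diff exp_minus exp_Ln [OF nz [OF that]] by simp
      moreover have "fiber_w (nearby_fiber 1 z) = z / 2" "fiber_x (nearby_fiber 1 z) = 1 * ?q z"
        by (rule nearby_fiber [OF _ that], simp)+
      then have "(?u \<circ> nearby_fiber 1) z = z / 2 / (1 + ?q z)"
        by (simp only: o_apply mult_1_left add.commute)
      ultimately show ?thesis
        by (simp only:) simp
    qed
  qed
  \<comment> \<open>Here \<open>X = - ?q z\<close>, and \<open>z / 2 = (?q z)^2 - 1\<close> cancels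
    the denominator \<open>1 - ?q z\<close>, leaving \<open>- (1 + ?q z)\<close>. The constant
    \<open>\<i> * pi\<close> in the logarithm accounts for the sign.\<close>
  moreover have "winding (?u \<circ> nearby_fiber (-1)) ?\<gamma> = 2 * pi * \<i> * of_nat 0"
  proof (rule winding_circle_loop)
    show "continuous_on (sphere 0 1) (\<lambda>z. \<i> * pi + Ln (1 + ?q z))"
      by (intro continuous_intros Ln)
    show "(?u \<circ> nearby_fiber (-1)) z = z ^ 0 * exp (\<i> * pi + Ln (1 + ?q z))" if z: "z \<in> sphere 0 1" for z
    proof -
      have alg: "w / (1 - q) = - (1 + q)" if "w = (q + 1) * (q - 1)" "q \<noteq> 1" for w q :: complex
        unfolding that(1) by (subst nonzero_divide_eq_eq) (use that(2) in \<open>simp_all add: algebra_simps\<close>)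
      have "z / 2 = (?q z + 1) * (?q z - 1)"
        using csqrt_half(1) [OF z] by (simp add: algebra_simps power2_eq_square)
      then have "z / 2 / (1 - ?q z) = - (1 + ?q z)"
        using csqrt_half(4) [OF z] by (rule alg)
      moreover have "fiber_w (nearby_fiber (-1) z) = z / 2" "fiber_x (nearby_fiber (-1) z) = -1 * ?q z"
        by (rule nearby_fiber [OF _ z], simp)+
      then have "(?u \<circ> nearby_fiber (-1)) z = z / 2 / (1 - ?q z)"
        by (simp only: o_apply mult_minus1 uminus_add_conv_diff)
      moreover have "exp (\<i> * pi + Ln (1 + ?q z)) = - (1 + ?q z)"
        unfolding exp_add exp_pi_i' exp_Ln [OF nz [OF z]] by (rule mult_minus1)
      ultimately show ?thesis
        by (simp only: power_0 mult_1_left)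
    qed
  qed
  ultimately have "winding ?u torsion_cycle = 2 * pi * \<i>"
    by (simp only: winding_diff winding_chain_map) simp
  with n have "of_int (int p * n) = (1 :: complex)"
    by simp
  then have "int p * n = 1"
    by (metis of_int_eq_1_iff)
  then show False
    using assms by (auto simp: zmult_eq_1_iff)
qed

end

section \<open>The polynomial on three chosen coordinates has both homological properties\<close>

theorem theorem1:
  fixes p l :: nat
  assumes "Factorial_Ring.prime p"
    and "l > 1"
    and "CARD('n::finite) = l + 1"
  shows "\<exists>(d :: nat) (f :: complex ^ 'n \<Rightarrow> complex).
    homogeneous_polynomial d f \<and> f 0 = 0 \<and>
    (\<forall>q::int. torsion_free_group
       (homology_group q (top_of_set (hypersurface_complement f)))) \<and>
    has_p_torsion p (homology_group 1 (top_of_set (milnor_fiber f)))"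
proof -
  \<comment> \<open>The bound \<open>l > 1\<close> provides the three distinct coordinates.\<close>
  have "card (UNIV :: 'n set) \<ge> 3"
    using assms by simp
  then obtain T :: "'n set" where "card T = 3"
    by (rule obtain_subset_with_card_n)
  then obtain i j k :: 'n where ijk: "i \<noteq> j" "i \<noteq> k" "j \<noteq> k"
    by (auto simp: card_3_iff)
  have p: "p > 1"
    using assms(1) by (rule prime_gt_1_nat)
  then have p0: "p > 0" by simp
  let ?f = "torsion_poly p i j k"
  \<comment> \<open>The torsion cycle was built in the open part \<open>X \<noteq> -1\<close> and is
    now regarded as a cycle of the whole fiber.\<close>
  have cycle: "singular_relcycle 1 (top_of_set (milnor_fiber ?f)) {} (torsion_cycle i j k p)"
    using torsion_cycle [OF ijk p0] singular_cycle_mono [of 1 euclidean _ _ "milnor_fiber ?f"] by blast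
  have "has_p_torsion p (homology_group (int 1) (top_of_set (milnor_fiber ?f)))"
    using has_p_torsionI [OF assms(1) cycle not_torsion_cycle_boundary [OF ijk p0 p] torsion_cycle_boundary [OF ijk p0]] .
  moreover have "?f 0 = 0"
    by (simp add: torsion_poly_def)
  ultimately show ?thesis
    using homogeneous_torsion_poly [OF ijk p0] torsion_free_homology_torsion_poly_complement [OF ijk p0]
    unfolding torsion_free_homology_def by (intro exI [of _ "2 * p + 2"] exI [of _ ?f]) simp
qed

end
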